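(* Let $F$ be a field of characteristic zero and $W$ a unital $\mathbb{Z}_2$-graded $F$-algebra. Let $UT_2$ be the $\mathbb{Z}_2$-graded $W$-algebra of $2\times 2$ upper triangular matrices over $F$ with the canonical grading, where $W$ acts on it as the algebra $UT_2$ itself by left and right multiplication. Fix the ordered basis $\{w_i\}_{i\in\mathcal I}$ of $W$ so that $w_0=1_W$, $w_1$, $w_2$ act on $UT_2$ as left and right multiplication by $1$, $e_{22}$, $e_{12}$ respectively, and $w_i$ acts as zero for all $i\ge3$. Then $\mathrm{Id}^{\mathbb{Z}_2,W}(UT_2)$ is generated, as a $T_{\mathbb{Z}_2,W}$-ideal, by the polynomials $$[y_1,y_2],\quad w_1y-yw_1,\quad zw_1-z,\quad w_1z,\quad yw_i,\quad w_iy,\quad zw_i,\quad w_iz\qquad (i\ge3).$$ Moreover, for all $n\ge1$, $c_n^{\mathbb{Z}_2,W}(UT_2)=2^{n-1}(n+2)+2$.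
   Context: The canonical grading is $UT_2^0=Fe_{11}\oplus Fe_{22}$, $UT_2^1=Fe_{12}$. "$W$ acts as a unital graded subalgebra $B\subseteq UT_2$ by left and right multiplication" means there is a surjective unital graded homomorphism $\varphi:W\to B$ with $wa=\varphi(w)a$, $aw=a\varphi(w)$; here $B=UT_2$, and $\varphi(w_0)=1$, $\varphi(w_1)=e_{22}$, $\varphi(w_2)=e_{12}$, $\varphi(w_i)=0$ for $i\ge3$ (i.e. for all remaining indices). $[a,b]=ab-ba$. Let $y_1,y_2,\dots$ be variables of degree $0$ and $z_1,z_2,\dots$ of degree $1$ ($y,z$ denote one such variable). The free $\mathbb{Z}_2$-graded $W$-algebra $W\langle Y,Z\rangle$ has vector space basis the monomials $w_{i_0}u_1w_{i_1}\cdots w_{i_{n-1}}u_nw_{i_n}$, $n\ge1$, each $u_j$ a variable; product is juxtaposition followed by multiplication in $W$, $W$ acts by multiplication at the two ends, a variable $x$ is identified with $1_Wx1_W$, and for homogeneous elements of $W$ the degree of a monomial is the sum of the degrees of its factors. $\mathrm{Id}^{\mathbb{Z}_2,W}(A)$ is the set of elements vanishing under all substitutions of $y$'s by elements of $A^0$ and $z$'s by elements of $A^1$. A $T_{\mathbb{Z}_2,W}$-ideal is a two-sided ideal, closed under the left and right $W$-action, invariant under all graded $W$-algebra endomorphisms of $W\langle Y,Z\rangle$. $P_n^{\mathbb{Z}_2,W}$ is the span of all monomials $w_{i_0}u_{\sigma(1)}w_{i_1}\cdots u_{\sigma(n)}w_{i_n}$ with $\sigma\in S_n$, each $u_i\in\{y_i,z_i\}$,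 and $c_n^{\mathbb{Z}_2,W}(A)=\dim_F P_n^{\mathbb{Z}_2,W}/(P_n^{\mathbb{Z}_2,W}\cap\mathrm{Id}^{\mathbb{Z}_2,W}(A))$. *)

theory Defs
  imports "HOL-Analysis.Analysis" "HOL-Library.Poly_Mapping" "HOL-Library.Z2"
begin

text \<open>
  Degrees live in \<^typ>\<open>bit\<close>, the integers modulo 2.  The algebra \<open>W\<close> is the type \<^typ>\<open>'w\<close>, a unital
  ring, together with the following data; the index type \<^typ>\<open>'i\<close> of the basis is arbitrary.
\<close>

record ('f, 'w, 'i) graded_algebra =
  scaleW :: "'f \<Rightarrow> 'w \<Rightarrow> 'w"
  gradeW :: "bit \<Rightarrow> 'w set"
  basisW :: "'i \<Rightarrow> 'w"

text \<open>The basis is not required to consist of homogeneous elements.\<close>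

locale Z2_graded_algebra = vector_space "scaleW W"
  for W :: "('f::field, 'w::ring_1, 'i) graded_algebra" +
  assumes scale_mult_left: "scaleW W c a * b = scaleW W c (a * b)"
    and scale_mult_right: "a * scaleW W c b = scaleW W c (a * b)"
    and subspace_grade: "subspace (gradeW W d)"
    and grade_disjoint: "gradeW W 0 \<inter> gradeW W 1 = {0}"
    and grade_sum: "\<exists>a\<in>gradeW W 0. \<exists>b\<in>gradeW W 1. x = a + b"
    and grade_mult: "a \<in> gradeW W d \<Longrightarrow> b \<in> gradeW W e \<Longrightarrow> a * b \<in> gradeW W (d + e)"
    and inj_basis: "inj (basisW W)"
    and independent_basis: "independent (range (basisW W))"
    and span_basis: "span (range (basisW W)) = UNIV"

definition coef :: "('f::field, 'w::ring_1, 'i) graded_algebra \<Rightarrow> 'w \<Rightarrow> 'i \<Rightarrow> 'f"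
  where "coef W a i = module.representation (scaleW W) (range (basisW W)) a (basisW W i)"


subsection \<open>The free graded \<open>W\<close>-algebra\<close>

text \<open>\<open>Y k\<close> and \<open>Z k\<close> are the variables \<open>y\<close> and \<open>z\<close> with index \<open>k + 1\<close>.\<close>

datatype var = Y nat | Z nat

fun var_degree :: "var \<Rightarrow> bit" where
  "var_degree (Y _) = 0"
| "var_degree (Z _) = 1"

text \<open>
  Basis monomials: \<open>Mono i u j\<close> is \<open>w\<^sub>i u w\<^sub>j\<close>, and \<open>Pre i u m\<close> is \<open>w\<^sub>i u m\<close>, where the monomial \<open>m\<close>
  supplies the \<open>W\<close>-factor to the right of \<open>u\<close>.  So every monomial contains at least one variable.
\<close>

datatype 'i mono = Mono 'i var 'i | Pre 'i var "'i mono"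

fun vars :: "'i mono \<Rightarrow> var list" where
  "vars (Mono _ u _) = [u]"
| "vars (Pre _ u m) = u # vars m"

type_synonym ('i, 'f) wpoly = "'i mono \<Rightarrow>\<^sub>0 'f"

definition pscale :: "'f::field \<Rightarrow> ('i, 'f) wpoly \<Rightarrow> ('i, 'f) wpoly"
  where "pscale c p = Poly_Mapping.map ((*) c) p"

definition lin :: "('i mono \<Rightarrow> ('i, 'f::field) wpoly) \<Rightarrow> ('i, 'f) wpoly \<Rightarrow> ('i, 'f) wpoly"
  where "lin f p = (\<Sum>m\<in>Poly_Mapping.keys p. pscale (Poly_Mapping.lookup p m) (f m))"

text \<open>\<open>expand W g a\<close> is the sum of \<open>coef W a k\<close> times the monomial \<open>g k\<close>.\<close>

definition expand ::
    "('f::field, 'w::ring_1, 'i) graded_algebra \<Rightarrow> ('i \<Rightarrow> 'i mono) \<Rightarrow> 'w \<Rightarrow> ('i, 'f) wpoly"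
  where "expand W g a = (\<Sum>k | coef W a k \<noteq> 0. Poly_Mapping.single (g k) (coef W a k))"

definition pre :: "'i \<Rightarrow> var \<Rightarrow> ('i, 'f::field) wpoly \<Rightarrow> ('i, 'f) wpoly"
  where "pre i u = lin (\<lambda>m. Poly_Mapping.single (Pre i u m) 1)"

primrec lactM :: "('f::field, 'w::ring_1, 'i) graded_algebra \<Rightarrow> 'w \<Rightarrow> 'i mono \<Rightarrow> ('i, 'f) wpoly" where
  "lactM W a (Mono i u j) = expand W (\<lambda>k. Mono k u j) (a * basisW W i)"
| "lactM W a (Pre i u m) = expand W (\<lambda>k. Pre k u m) (a * basisW W i)"

primrec ractM :: "('f::field, 'w::ring_1, 'i) graded_algebra \<Rightarrow> 'i mono \<Rightarrow> 'w \<Rightarrow> ('i, 'f) wpoly" where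
  "ractM W (Mono i u j) a = expand W (\<lambda>k. Mono i u k) (basisW W j * a)"
| "ractM W (Pre i u m) a = pre i u (ractM W m a)"

primrec multM :: "('f::field, 'w::ring_1, 'i) graded_algebra \<Rightarrow> 'i mono \<Rightarrow> 'i mono \<Rightarrow> ('i, 'f) wpoly" where
  "multM W (Mono i u j) m' = pre i u (lactM W (basisW W j) m')"
| "multM W (Pre i u m) m' = pre i u (multM W m m')"

definition lact :: "('f::field, 'w::ring_1, 'i) graded_algebra \<Rightarrow> 'w \<Rightarrow> ('i, 'f) wpoly \<Rightarrow> ('i, 'f) wpoly"
  where "lact W a = lin (lactM W a)"

definition ract :: "('f::field, 'w::ring_1, 'i) graded_algebra \<Rightarrow> ('i, 'f) wpoly \<Rightarrow> 'w \<Rightarrow> ('i, 'f) wpoly"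
  where "ract W p a = lin (\<lambda>m. ractM W m a) p"

definition pmult ::
    "('f::field, 'w::ring_1, 'i) graded_algebra \<Rightarrow> ('i, 'f) wpoly \<Rightarrow> ('i, 'f) wpoly \<Rightarrow> ('i, 'f) wpoly"
  where "pmult W p q = lin (\<lambda>m. lin (multM W m) q) p"

text \<open>A variable \<open>u\<close> is identified with \<open>1 u 1\<close>, here for a basis that need not contain \<open>1\<close>.\<close>

definition pvar :: "('f::field, 'w::ring_1, 'i) graded_algebra \<Rightarrow> var \<Rightarrow> ('i, 'f) wpoly"
  where "pvar W u = (\<Sum>i | coef W 1 i \<noteq> 0. \<Sum>j | coef W 1 j \<noteq> 0.
    Poly_Mapping.single (Mono i u j) (coef W 1 i * coef W 1 j))"

text \<open>
  \<open>homword W d p\<close>: \<open>p\<close> is a product \<open>a\<^sub>0 u\<^sub>1 a\<^sub>1 \<dots> u\<^sub>n a\<^sub>n\<close> with homogeneous \<open>a\<^sub>j \<in> W\<close> and total degree \<open>d\<close>.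
\<close>

inductive homword ::
    "('f::field, 'w::ring_1, 'i) graded_algebra \<Rightarrow> bit \<Rightarrow> ('i, 'f) wpoly \<Rightarrow> bool"
  for W :: "('f, 'w, 'i) graded_algebra" where
  base: "a \<in> gradeW W d \<Longrightarrow> b \<in> gradeW W e \<Longrightarrow>
    homword W (d + var_degree u + e) (lact W a (ract W (pvar W u) b))"
| step: "a \<in> gradeW W d \<Longrightarrow> homword W e p \<Longrightarrow>
    homword W (d + var_degree u + e) (lact W a (pmult W (pvar W u) p))"

definition pgrade :: "('f::field, 'w::ring_1, 'i) graded_algebra \<Rightarrow> bit \<Rightarrow> ('i, 'f) wpoly set"
  where "pgrade W d = module.span pscale {p. homword W d p}"

definition graded_endo ::
    "('f::field, 'w::ring_1, 'i) graded_algebra \<Rightarrow> (('i, 'f) wpoly \<Rightarrow> ('i, 'f) wpoly) \<Rightarrow> bool"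
  where "graded_endo W h \<longleftrightarrow>
    Vector_Spaces.linear pscale pscale h \<and>
    (\<forall>p q. h (pmult W p q) = pmult W (h p) (h q)) \<and>
    (\<forall>a p. h (lact W a p) = lact W a (h p)) \<and>
    (\<forall>p a. h (ract W p a) = ract W (h p) a) \<and>
    (\<forall>d. h ` pgrade W d \<subseteq> pgrade W d)"

definition T_ideal :: "('f::field, 'w::ring_1, 'i) graded_algebra \<Rightarrow> ('i, 'f) wpoly set \<Rightarrow> bool"
  where "T_ideal W J \<longleftrightarrow>
    module.subspace pscale J \<and>
    (\<forall>p\<in>J. \<forall>q. pmult W p q \<in> J \<and> pmult W q p \<in> J) \<and>
    (\<forall>p\<in>J. \<forall>a. lact W a p \<in> J \<and> ract W p a \<in> J) \<and>
    (\<forall>h. graded_endo W h \<longrightarrow> h ` J \<subseteq> J)"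

definition T_ideal_generated ::
    "('f::field, 'w::ring_1, 'i) graded_algebra \<Rightarrow> ('i, 'f) wpoly set \<Rightarrow> ('i, 'f) wpoly set"
  where "T_ideal_generated W S = \<Inter>{J. T_ideal W J \<and> S \<subseteq> J}"


subsection \<open>Identities and codimensions\<close>

record ('f, 'w, 'a) w_algebra =
  scaleA :: "'f \<Rightarrow> 'a \<Rightarrow> 'a"
  multA :: "'a \<Rightarrow> 'a \<Rightarrow> 'a"
  lactA :: "'w \<Rightarrow> 'a \<Rightarrow> 'a"
  ractA :: "'a \<Rightarrow> 'w \<Rightarrow> 'a"
  gradeA :: "bit \<Rightarrow> 'a set"

primrec evalM ::
    "('f::field, 'w::ring_1, 'i) graded_algebra \<Rightarrow> ('f, 'w, 'a) w_algebra \<Rightarrow> (var \<Rightarrow> 'a) \<Rightarrow> 'i mono \<Rightarrow> 'a" where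
  "evalM W A r (Mono i u j) = ractA A (lactA A (basisW W i) (r u)) (basisW W j)"
| "evalM W A r (Pre i u m) = multA A (lactA A (basisW W i) (r u)) (evalM W A r m)"

definition eval_poly ::
    "('f::field, 'w::ring_1, 'i) graded_algebra \<Rightarrow> ('f, 'w, 'a::ab_group_add) w_algebra \<Rightarrow> (var \<Rightarrow> 'a) \<Rightarrow>
     ('i, 'f) wpoly \<Rightarrow> 'a"
  where "eval_poly W A r p =
    (\<Sum>m\<in>Poly_Mapping.keys p. scaleA A (Poly_Mapping.lookup p m) (evalM W A r m))"

definition identities ::
    "('f::field, 'w::ring_1, 'i) graded_algebra \<Rightarrow> ('f, 'w, 'a::ab_group_add) w_algebra \<Rightarrow> ('i, 'f) wpoly set"
  where "identities W A =
    {p. \<forall>r. (\<forall>u. r u \<in> gradeA A (var_degree u)) \<longrightarrow> eval_poly W A r p = 0}"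

text \<open>The variables with indices \<open>1, \<dots>, n\<close> are those with argument in \<open>{..<n}\<close>.\<close>

definition multilinear :: "nat \<Rightarrow> ('i, 'f::field) wpoly set"
  where "multilinear n = module.span pscale
    {Poly_Mapping.single m 1 | m \<sigma> u. \<sigma> permutes {..<n} \<and> (\<forall>k<n. u k \<in> {Y k, Z k}) \<and>
       vars m = map (\<lambda>k. u (\<sigma> k)) [0..<n]}"

text \<open>
  \<open>quotient_basis s V U B\<close>: the cosets \<open>b + U\<close> for \<open>b \<in> B\<close> are pairwise distinct and form a finite
  basis of \<open>V / U\<close>.  As for \<^const>\<open>vector_space.dim\<close>, the dimension is 0 if there is no finite basis.
\<close>

definition quotient_basis ::
    "('f::field \<Rightarrow> 'v::ab_group_add \<Rightarrow> 'v) \<Rightarrow> 'v set \<Rightarrow> 'v set \<Rightarrow> 'v set \<Rightarrow> bool"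
  where "quotient_basis s V U B \<longleftrightarrow> finite B \<and> B \<subseteq> V \<and>
    (\<forall>v\<in>V. \<exists>c. v - (\<Sum>b\<in>B. s (c b) b) \<in> U) \<and>
    (\<forall>c. (\<Sum>b\<in>B. s (c b) b) \<in> U \<longrightarrow> (\<forall>b\<in>B. c b = 0))"

definition quotient_dim ::
    "('f::field \<Rightarrow> 'v::ab_group_add \<Rightarrow> 'v) \<Rightarrow> 'v set \<Rightarrow> 'v set \<Rightarrow> nat"
  where "quotient_dim s V U =
    (if \<exists>B. quotient_basis s V U B then card (SOME B. quotient_basis s V U B) else 0)"

definition codimension ::
    "('f::field, 'w::ring_1, 'i) graded_algebra \<Rightarrow> ('f, 'w, 'a::ab_group_add) w_algebra \<Rightarrow> nat \<Rightarrow> nat"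
  where "codimension W A n = quotient_dim pscale (multilinear n) (multilinear n \<inter> identities W A)"


subsection \<open>Upper triangular matrices\<close>

definition mscale :: "'f::field \<Rightarrow> 'f^2^2 \<Rightarrow> 'f^2^2"
  where "mscale c A = (\<chi> i j. c * A $ i $ j)"

definition munit :: "2 \<Rightarrow> 2 \<Rightarrow> ('f::field)^2^2"
  where "munit i j = axis i (axis j 1)"

definition UT2_set :: "(('f::field)^2^2) set"
  where "UT2_set = {A. A $ 2 $ 1 = 0}"

definition UT2_grade :: "bit \<Rightarrow> (('f::field)^2^2) set"
  where "UT2_grade d =
    (if d = 0 then {mscale a (munit 1 1) + mscale b (munit 2 2) | a b. True}
     else {mscale a (munit 1 2) | a. True})"

definition onto_UT2 :: "('f::field, 'w::ring_1, 'i) graded_algebra \<Rightarrow> ('w \<Rightarrow> 'f^2^2) \<Rightarrow> bool"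
  where "onto_UT2 W \<phi> \<longleftrightarrow>
    Vector_Spaces.linear (scaleW W) mscale \<phi> \<and>
    (\<forall>a b. \<phi> (a * b) = \<phi> a ** \<phi> b) \<and> \<phi> 1 = mat 1 \<and>
    (\<forall>d. \<phi> ` gradeW W d \<subseteq> UT2_grade d) \<and> range \<phi> = UT2_set"

text \<open>
  The underlying type contains all matrices, but \<^const>\<open>identities\<close> only substitutes elements of the
  homogeneous components, so only upper triangular matrices matter.
\<close>

definition UT2 :: "('w \<Rightarrow> 'f^2^2) \<Rightarrow> ('f::field, 'w, 'f^2^2) w_algebra"
  where "UT2 \<phi> = \<lparr>scaleA = mscale, multA = (**), lactA = (\<lambda>a x. \<phi> a ** x),
    ractA = (\<lambda>x a. x ** \<phi> a), gradeA = UT2_grade\<rparr>"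

end

theory Submission
  imports Defs
begin

text \<open>
  Modulo the generators, \<open>W\<close> acts through its image under \<open>\<phi>\<close>, so \<open>w\<^sub>1\<close> and \<open>w\<^sub>2\<close> can be handled as
  the matrix units \<open>e\<^sub>2\<^sub>2\<close> and \<open>e\<^sub>1\<^sub>2\<close>.  The factor \<open>w\<^sub>1\<close> commutes with every \<open>y\<close>, while \<open>w\<^sub>1 z = 0\<close> and
  \<open>z w\<^sub>1 = z\<close>.  Hence \<open>w\<^sub>1\<close> kills everything of the form \<open>y \<dots> y w\<^sub>2 \<dots>\<close> or \<open>y \<dots> y z \<dots>\<close>, and since
  \<open>z = z w\<^sub>1\<close> and \<open>w\<^sub>2 = w\<^sub>2 w\<^sub>1\<close>, a monomial in which the factors \<open>w\<^sub>2\<close> and \<open>z\<close> occur more than once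
  altogether vanishes.  As the \<open>y\<close>'s also commute with each other, every monomial is congruent to
  \<open>0\<close> or to one of the normal forms \<open>y\<^sub>L\<close>, \<open>w\<^sub>1 y\<^sub>L\<close>, \<open>y\<^sub>A w\<^sub>2 y\<^sub>B\<close>, \<open>y\<^sub>A z\<^sub>k y\<^sub>B\<close>, where \<open>L\<close>, \<open>A\<close> and \<open>B\<close>
  are multisets of indices.  This is \<open>mono_normal_J\<close>, which holds for every T-ideal containing the
  generators.

  Put \<open>diag(a\<^sub>k, b\<^sub>k)\<close> for \<open>y\<^sub>k\<close> and \<open>c\<^sub>k e\<^sub>1\<^sub>2\<close> for \<open>z\<^sub>k\<close>.  The normal forms then have the values
  \<open>a\<^sub>L e\<^sub>1\<^sub>1 + b\<^sub>L e\<^sub>2\<^sub>2\<close>, \<open>b\<^sub>L e\<^sub>2\<^sub>2\<close>, \<open>a\<^sub>A b\<^sub>B e\<^sub>1\<^sub>2\<close> and \<open>a\<^sub>A c\<^sub>k b\<^sub>B e\<^sub>1\<^sub>2\<close>.  Different monomials in the \<open>a\<^sub>k\<close>,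
  \<open>b\<^sub>k\<close>, \<open>c\<^sub>k\<close> are different multiplicative functions and so linearly independent, by Dedekind's
  lemma on characters (\<open>monomial_functions_independent\<close>).  Therefore no nontrivial combination of
  normal forms is an identity (\<open>shapes_independent\<close>).

  Replacing monomials by normal forms is thus a linear projection \<open>normalize\<close> whose kernel is the
  ideal of identities, and \<open>p - normalize p\<close> lies in every T-ideal containing the generators.
  This proves that the identities are generated as claimed.  It also shows that, for \<open>n \<ge> 1\<close>,
  the normal forms in which each index below \<open>n\<close> occurs once form a basis of the multilinear
  polynomials modulo the identities; there are \<open>1 + 1 + 2 ^ n + n * 2 ^ (n - 1)\<close> of them.
\<close>

section \<open>Linear maps on the free algebra\<close>

lemma lookup_pscale: "Poly_Mapping.lookup (pscale c p) m = c * Poly_Mapping.lookup p m"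
  by (simp add: pscale_def Poly_Mapping.map.rep_eq when_def)

interpretation wpoly: vector_space "pscale :: 'f::field \<Rightarrow> ('i, 'f) wpoly \<Rightarrow> ('i, 'f) wpoly"
  by unfold_locales (auto intro!: poly_mapping_eqI simp: lookup_pscale lookup_add algebra_simps)

interpretation matrix2: vector_space "mscale :: 'f::field \<Rightarrow> 'f^2^2 \<Rightarrow> 'f^2^2"
  by unfold_locales (auto simp: mscale_def vec_eq_iff algebra_simps)

abbreviation mpoly :: "'i mono \<Rightarrow> ('i, 'f::field) wpoly"
  where "mpoly m \<equiv> Poly_Mapping.single m 1"

lemma pscale_single: "pscale c (Poly_Mapping.single m d) = Poly_Mapping.single m (c * d)"
  by (auto intro!: poly_mapping_eqI simp: lookup_pscale lookup_single when_def)

lemma wpoly_eq_sum: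
  fixes p :: "('i, 'f::field) wpoly"
  shows "p = (\<Sum>m\<in>Poly_Mapping.keys p. pscale (Poly_Mapping.lookup p m) (mpoly m))"
  by (rule poly_mapping_eqI)
    (auto simp: lookup_sum lookup_pscale lookup_single when_def in_keys_iff if_distrib cong: if_cong)

lemma linear_wpoly_sum:
  assumes "Vector_Spaces.linear pscale s h"
  shows "h p = (\<Sum>m\<in>Poly_Mapping.keys p. s (Poly_Mapping.lookup p m) (h (mpoly m)))"
proof -
  interpret h: Vector_Spaces.linear pscale s h by fact
  have "h p = h (\<Sum>m\<in>Poly_Mapping.keys p. pscale (Poly_Mapping.lookup p m) (mpoly m))"
    using wpoly_eq_sum[of p] by (rule arg_cong)
  then show ?thesis by (simp add: h.sum h.scale)
qed

lemma linear_eq_on_monomials: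
  assumes "Vector_Spaces.linear pscale s g" "Vector_Spaces.linear pscale s h"
    and "\<And>m. g (mpoly m) = h (mpoly m)"
  shows "g p = h p"
  by (simp only: linear_wpoly_sum[OF assms(1), of p] linear_wpoly_sum[OF assms(2), of p] assms(3))

lemma lin_superset:
  assumes "finite S" "Poly_Mapping.keys p \<subseteq> S"
  shows "lin f p = (\<Sum>m\<in>S. pscale (Poly_Mapping.lookup p m) (f m))"
  unfolding lin_def using assms by (intro sum.mono_neutral_left) (auto simp: in_keys_iff)

lemma linear_lin: "Vector_Spaces.linear pscale pscale (lin f)"
proof (unfold_locales, goal_cases)
  case (1 p q)
  let ?S = "Poly_Mapping.keys p \<union> Poly_Mapping.keys q"
  have "Poly_Mapping.keys (p + q) \<subseteq> ?S" by (rule Poly_Mapping.keys_add)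
  then show ?case
    by (simp add: lin_superset[of ?S] lookup_add wpoly.scale_left_distrib sum.distrib)
next
  case (2 c p)
  have "Poly_Mapping.keys (pscale c p) \<subseteq> Poly_Mapping.keys p"
    by (auto simp: in_keys_iff lookup_pscale)
  then show ?case
    by (simp add: lin_superset[of "Poly_Mapping.keys p"] lookup_pscale wpoly.scale_sum_right)
qed

interpretation lin: Vector_Spaces.linear pscale pscale "lin f" for f
  by (rule linear_lin)

lemma lin_monomial [simp]: "lin f (mpoly m) = f m"
  by (simp add: lin_def)

lemma lin_id: "lin mpoly p = p"
  by (simp add: lin_def flip: wpoly_eq_sum)

lemma lin_in_subspace:
  assumes "wpoly.subspace J" "\<And>m. m \<in> Poly_Mapping.keys p \<Longrightarrow> f m \<in> J"
  shows "lin f p \<in> J"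
  unfolding lin_def using assms by (intro wpoly.subspace_sum wpoly.subspace_scale)

lemma linear_lin_fun: "lin (\<lambda>m. f m + g m) p = lin f p + lin g p"
    "lin (\<lambda>m. pscale c (f m)) p = pscale c (lin f p)"
    "lin (\<lambda>m. f m - g m) p = lin f p - lin g p"
  by (simp_all add: lin_def wpoly.scale_right_distrib sum.distrib wpoly.scale_sum_right
      mult.commute wpoly.scale_right_diff_distrib sum_subtractf)

lemma pre_monomial [simp]: "pre i u (mpoly m) = mpoly (Pre i u m)"
  by (simp add: pre_def)

lemma linear_pre: "Vector_Spaces.linear pscale pscale (pre i u)"
  unfolding pre_def by (rule linear_lin)

interpretation pre: Vector_Spaces.linear pscale pscale "pre i u" for i u
  by (rule linear_pre)

lemma linear_lact: "Vector_Spaces.linear pscale pscale (lact W a)"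
  unfolding lact_def by (rule linear_lin)

lemma linear_ract: "Vector_Spaces.linear pscale pscale (\<lambda>p. ract W p a)"
  unfolding ract_def by (rule linear_lin)

lemma linear_pmult_left: "Vector_Spaces.linear pscale pscale (\<lambda>p. pmult W p q)"
  unfolding pmult_def by (rule linear_lin)

lemma linear_pmult_right: "Vector_Spaces.linear pscale pscale (pmult W p)"
  unfolding pmult_def
  by unfold_locales (simp_all add: lin.add lin.scale linear_lin_fun)

interpretation lact: Vector_Spaces.linear pscale pscale "lact W a" for W a
  by (rule linear_lact)
interpretation ract: Vector_Spaces.linear pscale pscale "\<lambda>p. ract W p a" for W a
  by (rule linear_ract)
interpretation pmult_left: Vector_Spaces.linear pscale pscale "\<lambda>p. pmult W p q" for W q
  by (rule linear_pmult_left)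
interpretation pmult_right: Vector_Spaces.linear pscale pscale "pmult W p" for W p
  by (rule linear_pmult_right)

lemma lact_monomial [simp]: "lact W a (mpoly m) = lactM W a m"
  and ract_monomial [simp]: "ract W (mpoly m) a = ractM W m a"
  and pmult_monomials [simp]: "pmult W (mpoly m) (mpoly m') = multM W m m'"
  by (simp_all add: lact_def ract_def pmult_def)

section \<open>Coordinates in the acting algebra\<close>

context Z2_graded_algebra
begin

lemma finite_coef: "finite {k. coef W a k \<noteq> 0}"
proof -
  have "finite (basisW W -` {b. representation (range (basisW W)) a b \<noteq> 0})"
    using inj_basis finite_representation by (intro finite_vimageI) auto
  then show ?thesis by (simp add: coef_def vimage_def)
qed

lemma coef_basis [simp]: "coef W (basisW W i) k = (if k = i then 1 else 0)"
  unfolding coef_def using inj_basis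
  by (auto simp: representation_basis[OF independent_basis] inj_eq)

lemma linear_coef: "Vector_Spaces.linear (scaleW W) (*) (\<lambda>a. coef W a k)"
  by unfold_locales
    (auto simp: coef_def algebra_simps representation_add representation_scale independent_basis span_basis)

lemma coef_sum: "(\<Sum>k | coef W a k \<noteq> 0. scaleW W (coef W a k) (basisW W k)) = a"
proof -
  have "(\<Sum>b | representation (range (basisW W)) a b \<noteq> 0.
      scaleW W (representation (range (basisW W)) a b) b) = a"
    using independent_basis by (rule sum_nonzero_representation_eq) (simp add: span_basis)
  moreover have "{b. representation (range (basisW W)) a b \<noteq> 0}
      = basisW W ` {k. coef W a k \<noteq> 0}"
    using representation_ne_zero[of "range (basisW W)" a] by (auto simp: coef_def)
  ultimately show ?thesis
    using inj_basis by (simp add: sum.reindex inj_on_def coef_def)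
qed

lemma expand_superset:
  assumes "finite S" "{k. coef W a k \<noteq> 0} \<subseteq> S"
  shows "expand W g a = (\<Sum>k\<in>S. pscale (coef W a k) (mpoly (g k)))"
  unfolding expand_def using assms
  by (intro sum.mono_neutral_cong_left) (auto simp: pscale_single)

lemma expand_eq: "expand W g a = (\<Sum>k | coef W a k \<noteq> 0. pscale (coef W a k) (mpoly (g k)))"
  by (rule expand_superset) (auto simp: finite_coef)

lemma expand_basis [simp]: "expand W g (basisW W i) = mpoly (g i)"
  using expand_superset[of "{i}" "basisW W i" g] by (auto split: if_splits)

lemma expand_diff: "expand W g (a - b) = expand W g a - expand W g b"
proof -
  interpret c: Vector_Spaces.linear "scaleW W" "(*)" "\<lambda>a. coef W a k" for k
    by (rule linear_coef)
  let ?S = "{k. coef W a k \<noteq> 0} \<union> {k. coef W b k \<noteq> 0}"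
  have "{k. coef W (a - b) k \<noteq> 0} \<subseteq> ?S" by (auto simp: c.diff)
  then show ?thesis
    by (simp add: expand_superset[of ?S] finite_coef c.diff wpoly.scale_left_diff_distrib
        sum_subtractf)
qed

lemma lin_expand: "lin f (expand W g a) = (\<Sum>k | coef W a k \<noteq> 0. pscale (coef W a k) (f (g k)))"
  by (simp add: expand_eq lin.sum lin.scale)

text \<open>
  Write \<open>1 = a + b\<close> with \<open>a\<close> even and \<open>b\<close> odd.  For homogeneous \<open>x\<close> the product
  \<open>x * b = x - x * a\<close> lies in two different components, so it vanishes; then
  \<open>b = a * b + b * b = 0\<close>.
\<close>

lemma one_even: "1 \<in> gradeW W 0"
proof -
  obtain a b where a: "a \<in> gradeW W 0" and b: "b \<in> gradeW W 1" and ab: "1 = a + b"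
    using grade_sum by blast
  have z: "x * b = 0" if x: "x \<in> gradeW W d" for x d
  proof -
    have "x * b = x - x * a" by (metis ab add_diff_cancel_left' distrib_left mult.right_neutral)
    moreover have "x - x * a \<in> gradeW W d"
      using subspace_diff[OF subspace_grade x] grade_mult[OF x a] by (simp only: add_0_right)
    moreover have "x * b \<in> gradeW W (d + 1)" using grade_mult[OF x b] .
    ultimately have "x * b \<in> gradeW W d \<inter> gradeW W (d + 1)" by simp
    then show ?thesis using grade_disjoint by (cases d) auto
  qed
  have "b = a * b + b * b" by (metis ab distrib_right mult_1)
  also have "\<dots> = 0" using z[OF a] z[OF b] by simp
  finally show ?thesis using a ab by simp
qed

end

section \<open>Upper triangular matrices\<close>

lemma mscale_nth [simp]: "mscale c A $ i $ j = c * A $ i $ j"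
  by (simp add: mscale_def)

lemma munit_nth: "munit k l $ i $ j = (if i = k \<and> j = l then 1 else 0)"
  by (simp add: munit_def axis_def)

lemma UT2_grade_0: "A \<in> UT2_grade 0 \<longleftrightarrow> A $ 1 $ 2 = 0 \<and> A $ 2 $ 1 = 0"
proof
  assume "A $ 1 $ 2 = 0 \<and> A $ 2 $ 1 = 0"
  then have "A = mscale (A $ 1 $ 1) (munit 1 1) + mscale (A $ 2 $ 2) (munit 2 2)"
    by (auto simp: vec_eq_iff forall_2 munit_nth)
  then show "A \<in> UT2_grade 0" unfolding UT2_grade_def by auto
qed (auto simp: UT2_grade_def munit_nth)

lemma UT2_grade_1: "A \<in> UT2_grade 1 \<longleftrightarrow> A $ 1 $ 1 = 0 \<and> A $ 2 $ 1 = 0 \<and> A $ 2 $ 2 = 0"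
proof
  assume "A $ 1 $ 1 = 0 \<and> A $ 2 $ 1 = 0 \<and> A $ 2 $ 2 = 0"
  then have "A = mscale (A $ 1 $ 2) (munit 1 2)"
    by (auto simp: vec_eq_iff forall_2 munit_nth)
  then show "A \<in> UT2_grade 1" unfolding UT2_grade_def by auto
qed (auto simp: UT2_grade_def munit_nth)

lemma mmult_nth: "((A :: 'f::field^2^2) ** B) $ i $ j = A $ i $ 1 * B $ 1 $ j + A $ i $ 2 * B $ 2 $ j"
  by (simp add: matrix_matrix_mult_def sum_2)

lemmas matrix2_simps = vec_eq_iff forall_2 mmult_nth munit_nth

lemma UT2_grade_mult:
  assumes "A \<in> UT2_grade d" "B \<in> UT2_grade e"
  shows "A ** B \<in> UT2_grade (d + e)"
  using assms by (cases d; cases e) (auto simp: UT2_grade_0 UT2_grade_1 mmult_nth)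

lemma subspace_UT2_grade: "matrix2.subspace (UT2_grade d)"
  by (cases d) (auto simp: matrix2.subspace_def UT2_grade_0 UT2_grade_1)

lemma linear_mmult_left: "Vector_Spaces.linear mscale mscale (\<lambda>A. A ** B)"
  by unfold_locales (auto simp: matrix2_simps algebra_simps)

lemma linear_mmult_right: "Vector_Spaces.linear mscale mscale ((**) A)"
  by unfold_locales (auto simp: matrix2_simps algebra_simps)

interpretation mmult_left: Vector_Spaces.linear mscale mscale "\<lambda>A. A ** B" for B :: "'f::field^2^2"
  by (rule linear_mmult_left)
interpretation mmult_right: Vector_Spaces.linear mscale mscale "(**) A" for A :: "'f::field^2^2"
  by (rule linear_mmult_right)

section \<open>Evaluation in the upper triangular matrices\<close>

locale UT2_action = Z2_graded_algebra W
  for W :: "('f::field_char_0, 'w::ring_1, 'i) graded_algebra" +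
  fixes \<phi> :: "'w \<Rightarrow> 'f^2^2" and i0 i1 i2 :: 'i
  assumes onto: "onto_UT2 W \<phi>"
    and basis_i0: "basisW W i0 = 1"
    and phi_i1: "\<phi> (basisW W i1) = munit 2 2"
    and phi_i2: "\<phi> (basisW W i2) = munit 1 2"
    and phi_other: "i \<notin> {i0, i1, i2} \<Longrightarrow> \<phi> (basisW W i) = 0"
begin

lemma linear_phi: "Vector_Spaces.linear (scaleW W) mscale \<phi>"
  and phi_mult: "\<phi> (a * b) = \<phi> a ** \<phi> b"
  and phi_1: "\<phi> 1 = mat 1"
  and phi_grade: "a \<in> gradeW W d \<Longrightarrow> \<phi> a \<in> UT2_grade d"
  using onto by (auto simp: onto_UT2_def image_subset_iff)

sublocale phi: Vector_Spaces.linear "scaleW W" mscale \<phi>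
  by (rule linear_phi)

lemma phi_i0: "\<phi> (basisW W i0) = mat 1"
  by (simp add: basis_i0 phi_1)

lemma indices_distinct: "i0 \<noteq> i1" "i0 \<noteq> i2" "i1 \<noteq> i2"
proof -
  have "(mat 1 :: 'f^2^2) \<noteq> munit 2 2" "(mat 1 :: 'f^2^2) \<noteq> munit 1 2" "(munit 2 2 :: 'f^2^2) \<noteq> munit 1 2"
    by (auto simp: matrix2_simps mat_def)
  then show "i0 \<noteq> i1" "i0 \<noteq> i2" "i1 \<noteq> i2"
    using phi_i0 phi_i1 phi_i2 by metis+
qed

lemma phi_eq_sum: "\<phi> a = (\<Sum>k | coef W a k \<noteq> 0. mscale (coef W a k) (\<phi> (basisW W k)))"
proof -
  have "\<phi> a = \<phi> (\<Sum>k | coef W a k \<noteq> 0. scaleW W (coef W a k) (basisW W k))"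
    by (simp add: coef_sum)
  then show ?thesis by (simp add: phi.sum phi.scale)
qed

lemma coef_1: "coef W 1 k = (if k = i0 then 1 else 0)"
  using coef_basis[of i0 k] by (simp add: basis_i0)

lemma pvar_eq: "pvar W u = mpoly (Mono i0 u i0)"
proof -
  have "{k. coef W 1 k \<noteq> 0} = {i0}" by (auto simp: coef_1)
  then show ?thesis by (simp add: pvar_def coef_1)
qed

lemma expand_1: "expand W g 1 = mpoly (g i0)"
  using expand_basis[of g i0] by (simp add: basis_i0)

lemma Mono_eq: "mpoly (Mono i u j) = lact W (basisW W i) (ract W (pvar W u) (basisW W j))"
  by (simp add: pvar_eq basis_i0)

lemma lactM_1: "lactM W 1 m = mpoly m"
  by (cases m) simp_all

text \<open>
  Since \<open>1\<close> is the basis element \<open>w\<^sub>0\<close>, prefixing a monomial by \<open>w\<^sub>i u\<close> is an instance of the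
  algebra operations.  Hence everything stable under these operations is stable under \<open>pre\<close>, and a
  homomorphism is determined by its values on the variables.
\<close>
lemma pmult_pvar: "pmult W (pvar W u) p = pre i0 u p"
  by (rule linear_eq_on_monomials[OF linear_pmult_right linear_pre])
    (simp add: pvar_eq basis_i0 lactM_1)

lemma Pre_eq: "mpoly (Pre i u m) = lact W (basisW W i) (pmult W (pvar W u) (mpoly m))"
  by (simp add: pmult_pvar basis_i0)

lemma pre_eq: "pre i u p = lact W (basisW W i) (pmult W (pvar W u) p)"
proof (rule linear_eq_on_monomials[OF linear_pre])
  show "Vector_Spaces.linear pscale pscale (\<lambda>p. lact W (basisW W i) (pmult W (pvar W u) p))"
    by unfold_locales (simp_all add: lact.add lact.scale pmult_right.add pmult_right.scale)
qed (simp only: Pre_eq pre_monomial)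

abbreviation eval :: "(var \<Rightarrow> 'f^2^2) \<Rightarrow> ('i, 'f) wpoly \<Rightarrow> 'f^2^2"
  where "eval \<equiv> eval_poly W (UT2 \<phi>)"

abbreviation graded_point :: "(var \<Rightarrow> 'f^2^2) \<Rightarrow> bool"
  where "graded_point r \<equiv> (\<forall>u. r u \<in> UT2_grade (var_degree u))"

lemma eval_eq_sum: "eval r p = (\<Sum>m\<in>Poly_Mapping.keys p. mscale (Poly_Mapping.lookup p m) (evalM W (UT2 \<phi>) r m))"
  by (simp add: eval_poly_def UT2_def)

lemma linear_eval: "Vector_Spaces.linear pscale mscale (eval r)"
proof (unfold_locales, goal_cases)
  have superset: "eval r p = (\<Sum>m\<in>S. mscale (Poly_Mapping.lookup p m) (evalM W (UT2 \<phi>) r m))"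
    if "finite S" "Poly_Mapping.keys p \<subseteq> S" for S p
    unfolding eval_eq_sum using that by (intro sum.mono_neutral_left) (auto simp: in_keys_iff)
  {
    case (1 p q)
    let ?S = "Poly_Mapping.keys p \<union> Poly_Mapping.keys q"
    have "Poly_Mapping.keys (p + q) \<subseteq> ?S" by (rule Poly_Mapping.keys_add)
    then show ?case
      by (simp add: superset[of ?S] lookup_add matrix2.scale_left_distrib sum.distrib)
  next
    case (2 c p)
    have "Poly_Mapping.keys (pscale c p) \<subseteq> Poly_Mapping.keys p"
      by (auto simp: in_keys_iff lookup_pscale)
    then show ?case
      by (simp add: superset[of "Poly_Mapping.keys p"] lookup_pscale matrix2.scale_sum_right mult.commute)
  }
qed

sublocale eval: Vector_Spaces.linear pscale mscale "eval r" for r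
  by (rule linear_eval)

lemma eval_monomial [simp]: "eval r (mpoly m) = evalM W (UT2 \<phi>) r m"
  by (simp add: eval_eq_sum)

lemma evalM_simps [simp]:
  "evalM W (UT2 \<phi>) r (Mono i u j) = \<phi> (basisW W i) ** r u ** \<phi> (basisW W j)"
  "evalM W (UT2 \<phi>) r (Pre i u m) = \<phi> (basisW W i) ** r u ** evalM W (UT2 \<phi>) r m"
  by (simp_all add: UT2_def)

declare evalM.simps [simp del]

text \<open>
  The shared part of the three product formulas: expanding a coefficient of \<open>W\<close> in the basis and
  then evaluating is linear in that coefficient and only sees it through \<open>\<phi>\<close>.
\<close>
lemma eval_expand:
  assumes "Vector_Spaces.linear mscale mscale L" and "\<And>k. evalM W (UT2 \<phi>) r (g k) = L (\<phi> (basisW W k))"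
  shows "eval r (expand W g a) = L (\<phi> a)"
proof -
  interpret L: Vector_Spaces.linear mscale mscale L by fact
  show ?thesis
    by (subst phi_eq_sum) (simp add: expand_eq eval.sum eval.scale L.sum L.scale assms(2))
qed

lemma eval_lact: "eval r (lact W a p) = \<phi> a ** eval r p"
proof (rule linear_eq_on_monomials[of mscale])
  have "eval r (expand W (\<lambda>k. Mono k u j) b) = \<phi> b ** r u ** \<phi> (basisW W j)" for u j b
    by (rule eval_expand[of "\<lambda>A. A ** r u ** \<phi> (basisW W j)"])
      (unfold_locales, simp_all add: mmult_left.add mmult_left.scale)
  moreover have "eval r (expand W (\<lambda>k. Pre k u m) b) = \<phi> b ** r u ** evalM W (UT2 \<phi>) r m" for u m b
    by (rule eval_expand[of "\<lambda>A. A ** r u ** evalM W (UT2 \<phi>) r m"])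
      (unfold_locales, simp_all add: mmult_left.add mmult_left.scale)
  ultimately show "eval r (lact W a (mpoly m)) = \<phi> a ** eval r (mpoly m)" for m
    by (cases m) (simp_all add: phi_mult matrix_mul_assoc)
qed (unfold_locales, simp_all add: lact.add lact.scale eval.add eval.scale mmult_right.add mmult_right.scale)

lemma eval_pre: "eval r (pre i u p) = \<phi> (basisW W i) ** r u ** eval r p"
  by (rule linear_eq_on_monomials[of mscale])
    (unfold_locales, simp_all add: pre.add pre.scale eval.add eval.scale mmult_right.add mmult_right.scale)

lemma eval_ract: "eval r (ract W p a) = eval r p ** \<phi> a"
proof (rule linear_eq_on_monomials[of mscale])
  show "eval r (ract W (mpoly m) a) = eval r (mpoly m) ** \<phi> a" for m
  proof (induction m)
    case (Mono i u j)
    have "eval r (expand W (Mono i u) b) = \<phi> (basisW W i) ** r u ** \<phi> b" for b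
      by (rule eval_expand[of "\<lambda>A. \<phi> (basisW W i) ** r u ** A"])
        (unfold_locales, simp_all add: mmult_right.add mmult_right.scale)
    then show ?case by (simp add: phi_mult matrix_mul_assoc)
  qed (simp add: eval_pre matrix_mul_assoc)
qed (unfold_locales, simp_all add: ract.add ract.scale eval.add eval.scale mmult_left.add mmult_left.scale)

lemma eval_multM: "eval r (multM W m m') = eval r (mpoly m) ** eval r (mpoly m')"
  by (induction m) (simp_all add: eval_pre eval_lact matrix_mul_assoc flip: lact_monomial)

lemma eval_pmult: "eval r (pmult W p q) = eval r p ** eval r q"
proof (rule linear_eq_on_monomials[of mscale _ _ p])
  show "eval r (pmult W (mpoly m) q) = eval r (mpoly m) ** eval r q" for m
    by (rule linear_eq_on_monomials[of mscale _ _ q])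
      (unfold_locales, simp_all add: eval_multM pmult_right.add pmult_right.scale eval.add eval.scale
        mmult_right.add mmult_right.scale)
qed (unfold_locales, simp_all add: pmult_left.add pmult_left.scale eval.add eval.scale
    mmult_left.add mmult_left.scale)

lemma eval_pvar: "eval r (pvar W u) = r u"
  by (simp add: pvar_eq phi_i0)

lemma eval_grade:
  assumes "graded_point r" "p \<in> pgrade W d"
  shows "eval r p \<in> UT2_grade d"
proof -
  have hw: "eval r p \<in> UT2_grade d" if "homword W d p" for d p
    using that
  proof induction
    case (base a d b e u)
    have "\<phi> a ** r u ** \<phi> b \<in> UT2_grade (d + var_degree u + e)"
      using base assms(1) by (intro UT2_grade_mult phi_grade) auto
    then show ?case by (simp add: eval_lact eval_ract eval_pvar matrix_mul_assoc)
  next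
    case (step a d e p u)
    have "\<phi> a ** r u ** eval r p \<in> UT2_grade (d + var_degree u + e)"
      using step assms(1) by (intro UT2_grade_mult phi_grade) auto
    then show ?case by (simp add: eval_lact eval_pmult eval_pvar matrix_mul_assoc)
  qed
  have "wpoly.span {p. homword W d p} \<subseteq> eval r -` UT2_grade d"
    using hw by (intro wpoly.span_minimal eval.subspace_vimage subspace_UT2_grade) auto
  then show ?thesis using assms(2) by (auto simp: pgrade_def)
qed

lemma pvar_grade: "pvar W u \<in> pgrade W (var_degree u)"
proof -
  have "lact W 1 (ract W (pvar W u) 1) = pvar W u"
    using Mono_eq[of i0 u i0] by (simp only: basis_i0 pvar_eq)
  then have "homword W (var_degree u) (pvar W u)"
    using homword.base[OF one_even one_even, of u] by (simp only: add_0_left add_0_right)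
  then show ?thesis by (auto simp: pgrade_def intro: wpoly.span_base)
qed

lemma mem_identities: "p \<in> identities W (UT2 \<phi>) \<longleftrightarrow> (\<forall>r. graded_point r \<longrightarrow> eval r p = 0)"
  by (simp add: identities_def UT2_def)

text \<open>
  Evaluation at \<open>r\<close> after an endomorphism is evaluation at another point, and this point is again
  graded by \<open>eval_grade\<close>.  This is why the identities are stable under graded endomorphisms.
\<close>
lemma eval_endo:
  assumes h: "graded_endo W h"
  shows "eval r (h p) = eval (\<lambda>u. eval r (h (pvar W u))) p"
proof -
  interpret h: Vector_Spaces.linear pscale pscale h
    using h by (simp add: graded_endo_def)
  have hom: "h (pmult W p q) = pmult W (h p) (h q)" "h (lact W a p) = lact W a (h p)"
    "h (ract W p a) = ract W (h p) a" for p q a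
    using h by (simp_all add: graded_endo_def)
  show ?thesis
  proof (rule linear_eq_on_monomials[of mscale])
    show "eval r (h (mpoly m)) = eval (\<lambda>u. eval r (h (pvar W u))) (mpoly m)" for m
    proof (induction m)
      case (Mono i u j)
      show ?case
        unfolding Mono_eq hom eval_lact eval_ract eval_pvar by (rule refl)
    next
      case (Pre i u m)
      show ?case
        unfolding Pre_eq hom eval_lact eval_pmult eval_pvar Pre by (rule refl)
    qed
  qed (unfold_locales, simp_all add: h.add h.scale eval.add eval.scale)
qed

lemma T_ideal_identities: "T_ideal W (identities W (UT2 \<phi>))"
proof -
  have "wpoly.subspace (identities W (UT2 \<phi>))"
    by (auto simp: wpoly.subspace_def mem_identities eval.add eval.scale)
  moreover have "h p \<in> identities W (UT2 \<phi>)" if "graded_endo W h" "p \<in> identities W (UT2 \<phi>)" for h p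
  proof -
    have "eval r (h p) = 0" if r: "graded_point r" for r
    proof -
      have "graded_point (\<lambda>u. eval r (h (pvar W u)))"
        using \<open>graded_endo W h\<close> pvar_grade
        by (auto intro!: eval_grade[OF r] simp: graded_endo_def image_subset_iff)
      with \<open>p \<in> _\<close> have "eval (\<lambda>u. eval r (h (pvar W u))) p = 0" by (simp add: mem_identities)
      then show ?thesis by (simp only: eval_endo[OF \<open>graded_endo W h\<close>, of r p])
    qed
    then show ?thesis by (simp add: mem_identities)
  qed
  ultimately show ?thesis
    by (auto simp: T_ideal_def mem_identities eval_pmult eval_lact eval_ract
        mmult_left.zero mmult_right.zero)
qed

definition generators :: "('i, 'f) wpoly set" where
  "generators =
      ({pmult W (pvar W (Y 0)) (pvar W (Y 1)) - pmult W (pvar W (Y 1)) (pvar W (Y 0)),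
        lact W (basisW W i1) (pvar W (Y 0)) - ract W (pvar W (Y 0)) (basisW W i1),
        ract W (pvar W (Z 0)) (basisW W i1) - pvar W (Z 0),
        lact W (basisW W i1) (pvar W (Z 0))} \<union>
       (\<Union>i\<in>- {i0, i1, i2}.
         {ract W (pvar W (Y 0)) (basisW W i), lact W (basisW W i) (pvar W (Y 0)),
          ract W (pvar W (Z 0)) (basisW W i), lact W (basisW W i) (pvar W (Z 0))}))"

lemma generators_identities: "generators \<subseteq> identities W (UT2 \<phi>)"
proof -
  have "eval r p = 0" if r: "graded_point r" and p: "p \<in> generators" for r p
  proof -
    have "r (Y k) $ 1 $ 2 = 0" "r (Y k) $ 2 $ 1 = 0" for k
      using r[rule_format, of "Y k"] by (auto simp: UT2_grade_0)
    moreover have "r (Z k) $ 1 $ 1 = 0" "r (Z k) $ 2 $ 1 = 0" "r (Z k) $ 2 $ 2 = 0" for k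
      using r[rule_format, of "Z k"] by (auto simp: UT2_grade_1)
    ultimately show ?thesis using p
      by (auto simp: generators_def eval.diff eval_pmult eval_lact eval_ract eval_pvar phi_i1 phi_other
          matrix2_simps)
  qed
  then show ?thesis by (auto simp: mem_identities)
qed

end

section \<open>Linear independence of monomial functions\<close>

text \<open>
  The function \<open>x \<mapsto> \<Prod>e\<in>#M. x e\<close> is multiplicative in \<open>x\<close>, so this is Dedekind's independence of
  characters: subtracting the relation scaled by the \<open>N\<close>-monomial at \<open>x0\<close> from the relation at
  \<open>x0 * x\<close> removes the term of \<open>N\<close>.  Distinct multisets give distinct characters because \<open>2\<close> has
  infinite order in characteristic zero.
\<close>
lemma monomial_functions_independent:
  fixes c :: "'x multiset \<Rightarrow> 'f::field_char_0"
  assumes "finite S" "\<And>x. (\<Sum>M\<in>S. c M * (\<Prod>e\<in>#M. x e)) = 0" "M \<in> S"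
  shows "c M = 0"
  using assms
proof (induction S arbitrary: c M rule: finite_induct)
  case (insert N S)
  have S0: "c M = 0" if M: "M \<in> S" for M
  proof -
    have "M \<noteq> N" using M insert.hyps by blast
    then obtain v where v: "count M v \<noteq> count N v" by (auto simp: multiset_eq_iff)
    define x0 :: "'x \<Rightarrow> 'f" where "x0 = (\<lambda>e. if e = v then 2 else 1)"
    have x0: "(\<Prod>e\<in>#K. x0 e) = 2 ^ count K v" for K
      by (induction K) (auto simp: x0_def)
    have "c M * ((\<Prod>e\<in>#M. x0 e) - (\<Prod>e\<in>#N. x0 e)) = 0"
    proof (rule insert.IH[OF _ M])
      fix x
      let ?P = "\<lambda>x M. \<Prod>e\<in>#M. x e"
      have "0 = (\<Sum>M\<in>insert N S. c M * ?P (\<lambda>e. x0 e * x e) M) - ?P x0 N * (\<Sum>M\<in>insert N S. c M * ?P x M)"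
        by (simp only: insert.prems(1)) simp
      also have "\<dots> = (\<Sum>M\<in>insert N S. c M * (?P x0 M - ?P x0 N) * ?P x M)"
        by (simp add: sum_distrib_left prod_mset.distrib algebra_simps flip: sum_subtractf)
      also have "\<dots> = (\<Sum>M\<in>S. c M * (?P x0 M - ?P x0 N) * ?P x M)"
        using insert.hyps by simp
      finally show "(\<Sum>M\<in>S. c M * (?P x0 M - ?P x0 N) * ?P x M) = 0" by simp
    qed
    moreover have "(2::'f) ^ count M v \<noteq> 2 ^ count N v"
    proof -
      have "(of_nat (2 ^ count M v) :: 'f) \<noteq> of_nat (2 ^ count N v)"
        using v by (simp only: of_nat_eq_iff) simp
      then show ?thesis by simp
    qed
    ultimately show ?thesis by (simp add: x0)
  qed
  moreover have "c N = 0"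
    using insert.prems(1)[of "\<lambda>_. 1"] insert.hyps S0 by simp
  ultimately show ?case using insert.prems(2) by blast
qed simp

lemma monomial_family_independent:
  fixes c :: "'k \<Rightarrow> 'f::field_char_0"
  assumes "finite I" "inj_on g I" "\<And>x. (\<Sum>i\<in>I. c i * (\<Prod>e\<in>#g i. x e)) = 0" "i \<in> I"
  shows "c i = 0"
proof -
  have "(c \<circ> the_inv_into I g) (g i) = 0"
  proof (rule monomial_functions_independent[of "g ` I"])
    show "(\<Sum>M\<in>g ` I. (c \<circ> the_inv_into I g) M * (\<Prod>e\<in>#M. x e)) = 0" for x
      using assms(3)[of x] by (simp add: sum.reindex assms(2) the_inv_into_f_f)
  qed (use assms in auto)
  then show ?thesis using assms by (simp add: the_inv_into_f_f)
qed

section \<open>Normal forms and their values\<close>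

text \<open>
  A shape records what a monomial becomes modulo the identities.  With \<open>y\<^sub>L\<close> the product of the
  \<open>y\<close>'s with indices in \<open>L\<close>, in any order: \<open>Plain L\<close> is \<open>y\<^sub>L\<close>, \<open>Corner L\<close> is \<open>w\<^sub>1 y\<^sub>L\<close>,
  \<open>Upper A None B\<close> is \<open>y\<^sub>A w\<^sub>2 y\<^sub>B\<close> and \<open>Upper A (Some k) B\<close> is \<open>y\<^sub>A z\<^sub>k y\<^sub>B\<close>.  Empty index sets are
  allowed, so that \<open>Plain {#}\<close>, \<open>Corner {#}\<close> and \<open>Upper {#} None {#}\<close> stand for \<open>1\<close>, \<open>w\<^sub>1\<close> and
  \<open>w\<^sub>2\<close>.
\<close>
datatype shape =
    Zero
  | Plain "nat multiset"
  | Corner "nat multiset"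
  | Upper "nat multiset" "nat option" "nat multiset"

fun cons_var :: "var \<Rightarrow> shape \<Rightarrow> shape" where
  "cons_var (Y k) (Plain L) = Plain (add_mset k L)"
| "cons_var (Y k) (Corner L) = Corner (add_mset k L)"
| "cons_var (Y k) (Upper A s B) = Upper (add_mset k A) s B"
| "cons_var (Z k) (Plain L) = Upper {#} (Some k) L"
| "cons_var (Z k) (Corner L) = Upper {#} (Some k) L"
| "cons_var _ _ = Zero"

fun shape_value :: "(var \<Rightarrow> 'f^2^2) \<Rightarrow> shape \<Rightarrow> ('f::field)^2^2" where
  "shape_value r Zero = 0"
| "shape_value r (Plain L) =
    mscale (\<Prod>k\<in>#L. r (Y k) $ 1 $ 1) (munit 1 1) + mscale (\<Prod>k\<in>#L. r (Y k) $ 2 $ 2) (munit 2 2)"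
| "shape_value r (Corner L) = mscale (\<Prod>k\<in>#L. r (Y k) $ 2 $ 2) (munit 2 2)"
| "shape_value r (Upper A s B) =
    mscale ((\<Prod>k\<in>#A. r (Y k) $ 1 $ 1) * (case s of None \<Rightarrow> 1 | Some k \<Rightarrow> r (Z k) $ 1 $ 2)
        * (\<Prod>k\<in>#B. r (Y k) $ 2 $ 2))
      (munit 1 2)"

text \<open>
  The coordinates of a graded point: the two diagonal entries of the \<open>y\<close>'s and the corner entry of
  the \<open>z\<close>'s.  The entries of \<open>shape_value\<close> are monomials in them, listed by \<open>entries\<close>.
\<close>

datatype entry = Y11 nat | Y22 nat | Z12 nat

fun entries :: "shape \<Rightarrow> entry multiset" where
  "entries Zero = {#}"
| "entries (Plain L) = image_mset Y11 L"
| "entries (Corner L) = image_mset Y22 L"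
| "entries (Upper A s B) = image_mset Y11 A + (case s of None \<Rightarrow> {#} | Some k \<Rightarrow> {#Z12 k#}) + image_mset Y22 B"

lemma count_image_entry [simp]:
  "count (image_mset Y11 A) (Y11 k) = count A k"
  "count (image_mset Y11 A) (Y22 k) = 0"
  "count (image_mset Y11 A) (Z12 k) = 0"
  "count (image_mset Y22 A) (Y22 k) = count A k"
  "count (image_mset Y22 A) (Y11 k) = 0"
  "count (image_mset Y22 A) (Z12 k) = 0"
  by (induction A) auto

lemma inj_entries_Upper: "inj_on entries {\<nu>. \<exists>A s B. \<nu> = Upper A s B}"
proof (rule inj_onI, clarify)
  fix A s B A' s' B'
  assume eq: "entries (Upper A s B) = entries (Upper A' s' B')"
  have "count A k = count A' k" for k
    using arg_cong[OF eq, of "\<lambda>M. count M (Y11 k)"] by (auto split: option.splits)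
  moreover have "count B k = count B' k" for k
    using arg_cong[OF eq, of "\<lambda>M. count M (Y22 k)"] by (auto split: option.splits)
  moreover have "s = Some k \<longleftrightarrow> s' = Some k" for k
    using arg_cong[OF eq, of "\<lambda>M. count M (Z12 k)"] by (auto split: option.splits if_splits)
  then have "s = s'" by (metis not_Some_eq)
  ultimately show "A = A' \<and> s = s' \<and> B = B'" by (simp add: multiset_eq_iff)
qed

text \<open>
  Each kind of shape has one matrix position where its values are distinct monomials in the
  coordinates.  In position \<open>(1,1)\<close> only \<open>Plain\<close> shapes occur; once their coefficients vanish,
  only \<open>Corner\<close> shapes are left in position \<open>(2,2)\<close>; and position \<open>(1,2)\<close> sees exactly the \<open>Upper\<close>
  shapes.
\<close>
lemma shapes_independent:
  fixes c :: "shape \<Rightarrow> 'f::field_char_0"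
  assumes fin: "finite K" and nz: "Zero \<notin> K"
    and sum0: "\<And>r. (\<forall>u. r u \<in> UT2_grade (var_degree u)) \<Longrightarrow> (\<Sum>\<nu>\<in>K. mscale (c \<nu>) (shape_value r \<nu>)) = 0"
    and "\<nu> \<in> K"
  shows "c \<nu> = 0"
proof -
  define point :: "(entry \<Rightarrow> 'f) \<Rightarrow> var \<Rightarrow> 'f^2^2" where
    "point x u = (case u of Y k \<Rightarrow> mscale (x (Y11 k)) (munit 1 1) + mscale (x (Y22 k)) (munit 2 2)
      | Z k \<Rightarrow> mscale (x (Z12 k)) (munit 1 2))" for x u
  have point: "point x (Y k) $ 1 $ 1 = x (Y11 k)" "point x (Y k) $ 2 $ 2 = x (Y22 k)"
    "point x (Z k) $ 1 $ 2 = x (Z12 k)" for x k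
    by (simp_all add: point_def munit_nth)
  have graded: "\<forall>u. point x u \<in> UT2_grade (var_degree u)" for x
  proof
    fix u show "point x u \<in> UT2_grade (var_degree u)"
      by (cases u) (auto simp: UT2_grade_0 UT2_grade_1 point_def munit_nth)
  qed
  have sum_entry: "(\<Sum>\<nu>\<in>K. c \<nu> * shape_value (point x) \<nu> $ i $ j) = 0" for x i j
    using arg_cong[OF sum0[OF graded[of x]], of "\<lambda>A. A $ i $ j"] by (simp add: sum_component)
  have val: "shape_value (point x) (Plain L) $ 1 $ 1 = (\<Prod>e\<in>#entries (Plain L). x e)"
    "shape_value (point x) (Corner L) $ 2 $ 2 = (\<Prod>e\<in>#entries (Corner L). x e)"
    "shape_value (point x) (Upper A s B) $ 1 $ 2 = (\<Prod>e\<in>#entries (Upper A s B). x e)" for x L A s B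
    by (simp_all add: munit_nth point multiset.map_comp comp_def split: option.splits)
  have off: "shape_value r (Plain L) $ 1 $ 2 = 0" "shape_value r (Corner L) $ 1 $ 1 = 0"
    "shape_value r (Corner L) $ 1 $ 2 = 0" "shape_value r (Upper A s B) $ 1 $ 1 = 0"
    "shape_value r (Upper A s B) $ 2 $ 2 = 0" for r :: "var \<Rightarrow> 'f^2^2" and L A s B
    by (simp_all add: munit_nth)
  \<comment> \<open>\<open>R\<close> is the kind of shape that survives in the matrix position \<open>(i, j)\<close>\<close>
  have part: "c \<nu> = 0"
    if R: "\<nu> \<in> K \<inter> R" "inj_on entries R"
      "\<And>x \<nu>. \<nu> \<in> K \<inter> R \<Longrightarrow> shape_value (point x) \<nu> $ i $ j = (\<Prod>e\<in>#entries \<nu>. x e)"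
      "\<And>x \<nu>. \<nu> \<in> K - R \<Longrightarrow> c \<nu> * shape_value (point x) \<nu> $ i $ j = 0" for R i j \<nu>
  proof (rule monomial_family_independent[of "K \<inter> R" entries c])
    show "inj_on entries (K \<inter> R)" using R(2) by (rule inj_on_subset) simp
    fix x
    have "(\<Sum>\<nu>\<in>K \<inter> R. c \<nu> * (\<Prod>e\<in>#entries \<nu>. x e)) = (\<Sum>\<nu>\<in>K \<inter> R. c \<nu> * shape_value (point x) \<nu> $ i $ j)"
      by (rule sum.cong) (auto simp: R(3))
    also have "\<dots> = (\<Sum>\<nu>\<in>K. c \<nu> * shape_value (point x) \<nu> $ i $ j)"
      using fin R(4) by (intro sum.mono_neutral_left) auto
    finally show "(\<Sum>\<nu>\<in>K \<inter> R. c \<nu> * (\<Prod>e\<in>#entries \<nu>. x e)) = 0" by (simp add: sum_entry)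
  qed (use fin R(1) in auto)
  have inj: "inj_on entries (range Plain)" "inj_on entries (range Corner)"
    by (auto simp: inj_on_def dest!: multiset.inj_map[THEN injD, rotated])
  have plain: "c \<nu> = 0" if "\<nu> \<in> K" "\<nu> = Plain L" for \<nu> L
  proof (rule part[of _ "range Plain" 1 1])
    show "c \<nu> * shape_value (point x) \<nu> $ 1 $ 1 = 0" if "\<nu> \<in> K - range Plain" for x \<nu>
      using that nz off by (cases \<nu>) auto
  qed (use that inj val in \<open>auto simp del: shape_value.simps entries.simps\<close>)
  have corner: "c \<nu> = 0" if "\<nu> \<in> K" "\<nu> = Corner L" for \<nu> L
  proof (rule part[of _ "range Corner" 2 2])
    show "c \<nu> * shape_value (point x) \<nu> $ 2 $ 2 = 0" if "\<nu> \<in> K - range Corner" for x \<nu>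
      using that nz off plain by (cases \<nu>) auto
  qed (use that inj val in \<open>auto simp del: shape_value.simps entries.simps\<close>)
  have upper: "c \<nu> = 0" if "\<nu> \<in> K" "\<nu> = Upper A s B" for \<nu> A s B
  proof (rule part[of _ "{\<nu>. \<exists>A s B. \<nu> = Upper A s B}" 1 2])
    show "c \<nu> * shape_value (point x) \<nu> $ 1 $ 2 = 0" if "\<nu> \<in> K - {\<nu>. \<exists>A s B. \<nu> = Upper A s B}" for x \<nu>
      using that nz off by (cases \<nu>) auto
  qed (use that inj_entries_Upper val in \<open>auto simp del: shape_value.simps entries.simps\<close>)
  show ?thesis using assms(4) nz plain corner upper by (cases \<nu>) auto
qed

fun index :: "var \<Rightarrow> nat" where
  "index (Y k) = k"
| "index (Z k) = k"

fun content :: "shape \<Rightarrow> nat multiset" where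
  "content Zero = {#}"
| "content (Plain L) = L"
| "content (Corner L) = L"
| "content (Upper A s B) = A + (case s of None \<Rightarrow> {#} | Some k \<Rightarrow> {#k#}) + B"

lemma cons_var_Zero [simp]: "cons_var u Zero = Zero"
  by (cases u) simp_all

lemma content_cons_var: "cons_var u \<nu> \<noteq> Zero \<Longrightarrow> content (cons_var u \<nu>) = add_mset (index u) (content \<nu>)"
  by (cases "(u, \<nu>)" rule: cons_var.cases) auto

lemma shape_value_cons_var:
  assumes "\<forall>u. r u \<in> UT2_grade (var_degree u)"
  shows "shape_value r (cons_var u \<nu>) = r u ** shape_value r \<nu>"
proof -
  have "r (Y k) $ 1 $ 2 = 0" "r (Y k) $ 2 $ 1 = 0" for k
    using assms[rule_format, of "Y k"] by (auto simp: UT2_grade_0)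
  moreover have "r (Z k) $ 1 $ 1 = 0" "r (Z k) $ 2 $ 1 = 0" "r (Z k) $ 2 $ 2 = 0" for k
    using assms[rule_format, of "Z k"] by (auto simp: UT2_grade_1)
  ultimately show ?thesis
    by (cases "(u, \<nu>)" rule: cons_var.cases) (auto simp: matrix2_simps)
qed

context UT2_action
begin

definition act_shape :: "'i \<Rightarrow> shape \<Rightarrow> shape" where
  "act_shape i \<nu> =
    (if i = i0 then \<nu>
     else if i = i1 then (case \<nu> of Plain L \<Rightarrow> Corner L | Corner L \<Rightarrow> Corner L | _ \<Rightarrow> Zero)
     else if i = i2 then (case \<nu> of Plain L \<Rightarrow> Upper {#} None L | Corner L \<Rightarrow> Upper {#} None L | _ \<Rightarrow> Zero)
     else Zero)"

text \<open>
  The last factor \<open>w\<^sub>j\<close> is read as \<open>w\<^sub>j\<close> acting on the shape of \<open>1\<close>, so the end of a monomial follows the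
  same rules as every other position.
\<close>
primrec mono_shape :: "'i mono \<Rightarrow> shape" where
  "mono_shape (Mono i u j) = act_shape i (cons_var u (act_shape j (Plain {#})))"
| "mono_shape (Pre i u m) = act_shape i (cons_var u (mono_shape m))"

lemma act_shape_simps [simp]:
  "act_shape i Zero = Zero"
  "act_shape i0 \<nu> = \<nu>"
  "act_shape i1 (Plain L) = Corner L"
  "act_shape i1 (Corner L) = Corner L"
  "act_shape i1 (Upper A s B) = Zero"
  "act_shape i2 (Plain L) = Upper {#} None L"
  "act_shape i2 (Corner L) = Upper {#} None L"
  "act_shape i2 (Upper A s B) = Zero"
  "i \<noteq> i0 \<Longrightarrow> i \<noteq> i1 \<Longrightarrow> i \<noteq> i2 \<Longrightarrow> act_shape i \<nu> = Zero"
  using indices_distinct by (auto simp: act_shape_def)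

lemma index_cases:
  obtains "i = i0" | "i = i1" | "i = i2" | "i \<noteq> i0" "i \<noteq> i1" "i \<noteq> i2" by blast

lemma content_act_shape: "act_shape i \<nu> \<noteq> Zero \<Longrightarrow> content (act_shape i \<nu>) = content \<nu>"
  by (cases i rule: index_cases; cases \<nu>) auto

lemma content_mono_shape: "mono_shape m \<noteq> Zero \<Longrightarrow> content (mono_shape m) = mset (map index (vars m))"
proof (induction m)
  case (Mono i u j)
  let ?\<nu> = "act_shape j (Plain {#})"
  have "cons_var u ?\<nu> \<noteq> Zero \<and> ?\<nu> \<noteq> Zero"
    using Mono by auto
  with Mono show ?case by (simp add: content_act_shape content_cons_var)
next
  case (Pre i u m)
  have "cons_var u (mono_shape m) \<noteq> Zero \<and> mono_shape m \<noteq> Zero"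
    using Pre.prems by auto
  with Pre show ?case by (simp add: content_act_shape content_cons_var)
qed

lemma shape_value_act: "shape_value r (act_shape i \<nu>) = \<phi> (basisW W i) ** shape_value r \<nu>"
  by (cases i rule: index_cases; cases \<nu>)
    (auto simp: phi_i0 phi_i1 phi_i2 phi_other matrix2_simps mat_def)

lemma shape_value_one: "shape_value r (Plain {#}) = mat 1"
  by (auto simp: matrix2_simps mat_def)

lemma evalM_eq_shape_value: "graded_point r \<Longrightarrow> evalM W (UT2 \<phi>) r m = shape_value r (mono_shape m)"
proof (induction m)
  case (Mono i u j)
  have "shape_value r (mono_shape (Mono i u j)) = \<phi> (basisW W i) ** (r u ** (\<phi> (basisW W j) ** mat 1))"
    by (simp only: mono_shape.simps shape_value_act shape_value_cons_var[OF Mono] shape_value_one)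
  then show ?case by (simp add: matrix_mul_assoc)
next
  case (Pre i u m)
  then show ?case
    by (simp add: shape_value_act shape_value_cons_var matrix_mul_assoc)
qed

lemma eval_eq_shape_sum:
  assumes "graded_point r"
  shows "eval r p = (\<Sum>m\<in>Poly_Mapping.keys p. mscale (Poly_Mapping.lookup p m) (shape_value r (mono_shape m)))"
  unfolding eval_eq_sum using assms by (simp add: evalM_eq_shape_value)

text \<open>Independence of the shapes, in the form used for identities: no cancellation is possible in a
  polynomial whose monomials have pairwise distinct shapes.\<close>
lemma identity_zero_if_shapes_distinct:
  assumes p: "p \<in> identities W (UT2 \<phi>)" and inj: "inj_on mono_shape (Poly_Mapping.keys p)"
    and nz: "Zero \<notin> mono_shape ` Poly_Mapping.keys p"
  shows "p = 0"
proof -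
  let ?K = "Poly_Mapping.keys p" and ?g = "the_inv_into (Poly_Mapping.keys p) mono_shape"
  have "Poly_Mapping.lookup p m = 0" if m: "m \<in> ?K" for m
  proof -
    have "(Poly_Mapping.lookup p \<circ> ?g) (mono_shape m) = 0"
    proof (rule shapes_independent[of "mono_shape ` ?K"])
      fix r :: "var \<Rightarrow> 'f^2^2" assume r: "graded_point r"
      have "(\<Sum>\<nu>\<in>mono_shape ` ?K. mscale ((Poly_Mapping.lookup p \<circ> ?g) \<nu>) (shape_value r \<nu>)) = eval r p"
        by (simp add: sum.reindex[OF inj] eval_eq_shape_sum[OF r] the_inv_into_f_f[OF inj])
      then show "(\<Sum>\<nu>\<in>mono_shape ` ?K. mscale ((Poly_Mapping.lookup p \<circ> ?g) \<nu>) (shape_value r \<nu>)) = 0"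
        using p r by (simp add: mem_identities)
    qed (use nz m in auto)
    then show ?thesis using m by (simp add: the_inv_into_f_f[OF inj])
  qed
  then have "?K = {}" by (metis equals0I in_keys_iff)
  then show ?thesis by simp
qed

end

section \<open>Monomials as words\<close>

primrec rename :: "(var \<Rightarrow> var) \<Rightarrow> 'i mono \<Rightarrow> 'i mono" where
  "rename \<rho> (Mono i u j) = Mono i (\<rho> u) j"
| "rename \<rho> (Pre i u m) = Pre i (\<rho> u) (rename \<rho> m)"

text \<open>
  \<open>word i [(u, j), (v, l)]\<close> is the monomial \<open>w\<^sub>i u w\<^sub>j v w\<^sub>l\<close>.  With the first index kept apart, a
  basis element acting from the left changes that index alone.  The empty list stands for a tail
  without variables; it is not a monomial, and \<open>word\<close> is left unspecified there.
\<close>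
fun word :: "'i \<Rightarrow> (var \<times> 'i) list \<Rightarrow> 'i mono" where
  "word i [(u, j)] = Mono i u j"
| "word i ((u, j) # q # ps) = Pre i u (word j (q # ps))"

lemma word_Cons: "ps \<noteq> [] \<Longrightarrow> word i ((u, j) # ps) = Pre i u (word j ps)"
  by (cases ps) auto

text \<open>
  The last index is a separate argument because the factor \<open>w\<^sub>2\<close> of \<open>y\<^sub>A w\<^sub>2 y\<^sub>B\<close> sits behind the last
  variable of \<open>y\<^sub>A\<close>.
\<close>
fun y_pairs :: "nat list \<Rightarrow> 'i \<Rightarrow> 'i \<Rightarrow> (var \<times> 'i) list" where
  "y_pairs [] d j = []"
| "y_pairs (k # L) d j = (Y k, if L = [] then j else d) # y_pairs L d j"

lemma y_pairs_eq_Nil [simp]: "y_pairs L d j = [] \<longleftrightarrow> L = []"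
  by (cases L) auto

context UT2_action
begin

lemma lin_expand_rename:
  "(\<And>k. f (g k) = mpoly (g' k)) \<Longrightarrow> lin f (expand W g a) = expand W g' a"
  by (simp only: lin_expand expand_eq[of g'])

text \<open>
  The generators mention only \<open>y\<^sub>1\<close>, \<open>y\<^sub>2\<close> and \<open>z\<^sub>1\<close>.  These endomorphisms carry them to all other
  variables.
\<close>
lemma graded_endo_rename:
  assumes deg: "\<And>u. var_degree (\<rho> u) = var_degree u"
  shows "graded_endo W (lin (\<lambda>m. mpoly (rename \<rho> m)))" (is "graded_endo W ?h")
proof -
  have lact: "?h (lact W a p) = lact W a (?h p)" for a p
    by (rule linear_eq_on_monomials[of pscale _ _ p])
      (unfold_locales, simp_all add: lin.add lin.scale lact.add lact.scale,
        rename_tac m, case_tac m, simp_all add: lin_expand_rename)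
  have pre: "?h (pre i u p) = pre i (\<rho> u) (?h p)" for i u p
    by (rule linear_eq_on_monomials[of pscale _ _ p])
      (unfold_locales, simp_all add: lin.add lin.scale pre.add pre.scale)
  have ractM: "?h (ractM W m a) = ractM W (rename \<rho> m) a" for m a
    by (induction m) (simp_all add: lin_expand_rename pre)
  have ract: "?h (ract W p a) = ract W (?h p) a" for a p
    by (rule linear_eq_on_monomials[of pscale _ _ p])
      (unfold_locales, simp_all add: lin.add lin.scale ract.add ract.scale ractM)
  have multM: "?h (multM W m m') = multM W (rename \<rho> m) (rename \<rho> m')" for m m'
    by (induction m) (simp_all add: pre lact flip: lact_monomial)
  have pmult1: "?h (pmult W (mpoly m) q) = pmult W (?h (mpoly m)) (?h q)" for m q
    by (rule linear_eq_on_monomials[of pscale _ _ q])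
      (unfold_locales, simp_all add: lin.add lin.scale pmult_right.add pmult_right.scale multM)
  have pmult: "?h (pmult W p q) = pmult W (?h p) (?h q)" for p q
    by (rule linear_eq_on_monomials[of pscale _ _ p])
      (unfold_locales, simp_all add: lin.add lin.scale pmult_left.add pmult_left.scale pmult1 del: lin_monomial)
  have pvar: "?h (pvar W u) = pvar W (\<rho> u)" for u
    by (simp add: pvar_eq)
  have "homword W d (?h p)" if "homword W d p" for d p
    using that
  proof induction
    case (base a d b e u)
    then show ?case
      using homword.base[of a W d b e "\<rho> u"] by (simp only: lact ract pvar deg)
  next
    case (step a d e p u)
    then show ?case
      using homword.step[of a W d e "?h p" "\<rho> u"] by (simp only: lact pmult pvar deg)
  qed
  then have "wpoly.span {p. homword W d p} \<subseteq> ?h -` wpoly.span {p. homword W d p}" for d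
    by (intro wpoly.span_minimal lin.subspace_vimage) (auto intro: wpoly.span_base)
  then show ?thesis
    unfolding graded_endo_def pgrade_def using linear_lin pmult lact ract by auto
qed

lemma phi_eq_coef:
  "\<phi> a = mscale (coef W a i0) (mat 1) + mscale (coef W a i1) (munit 2 2) + mscale (coef W a i2) (munit 1 2)"
proof -
  have "\<phi> a = (\<Sum>k\<in>{i0, i1, i2} \<union> {k. coef W a k \<noteq> 0}. mscale (coef W a k) (\<phi> (basisW W k)))"
    by (subst phi_eq_sum) (intro sum.mono_neutral_left; auto simp: finite_coef)
  also have "\<dots> = (\<Sum>k\<in>{i0, i1, i2}. mscale (coef W a k) (\<phi> (basisW W k)))"
    by (intro sum.mono_neutral_right) (auto simp: finite_coef phi_other)
  finally show ?thesis
    using indices_distinct by (simp add: phi_i0 phi_i1 phi_i2 add.assoc)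
qed

lemma coef_kernel:
  assumes "\<phi> a = 0"
  shows "coef W a i0 = 0" "coef W a i1 = 0" "coef W a i2 = 0"
  using phi_eq_coef[of a] unfolding assms by (auto simp: matrix2_simps mat_def)

text \<open>
  The monomial \<open>word (front \<nu>) (pairs \<nu>)\<close> representing the shape \<open>\<nu>\<close> has its \<open>y\<close>'s in increasing
  order.  The factor \<open>w\<^sub>2\<close> of \<open>y\<^sub>A w\<^sub>2 y\<^sub>B\<close> follows the last variable of \<open>y\<^sub>A\<close>, so it becomes the first
  index when \<open>A\<close> is empty.
\<close>
definition front :: "shape \<Rightarrow> 'i" where
  "front \<nu> = (case \<nu> of Corner L \<Rightarrow> i1 | Upper A None B \<Rightarrow> if A = {#} then i2 else i0 | _ \<Rightarrow> i0)"

abbreviation sorted_y :: "nat multiset \<Rightarrow> 'i \<Rightarrow> (var \<times> 'i) list" where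
  "sorted_y L j \<equiv> y_pairs (sorted_list_of_multiset L) i0 j"

fun pairs :: "shape \<Rightarrow> (var \<times> 'i) list" where
  "pairs Zero = []"
| "pairs (Plain L) = sorted_y L i0"
| "pairs (Corner L) = sorted_y L i0"
| "pairs (Upper A None B) = sorted_y A i2 @ sorted_y B i0"
| "pairs (Upper A (Some k) B) = sorted_y A i0 @ (Z k, i0) # sorted_y B i0"

definition normal_mono :: "shape \<Rightarrow> 'i mono" where
  "normal_mono \<nu> = word (front \<nu>) (pairs \<nu>)"

definition normal_poly :: "shape \<Rightarrow> ('i, 'f) wpoly" where
  "normal_poly \<nu> = (if \<nu> = Zero then 0 else mpoly (normal_mono \<nu>))"

lemma sorted_list_eq_Nil [simp]: "sorted_list_of_multiset M = [] \<longleftrightarrow> M = {#}"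
  by (metis mset_sorted_list_of_multiset mset_zero_iff)

lemma pairs_nonempty: "content \<nu> \<noteq> {#} \<Longrightarrow> pairs \<nu> \<noteq> []"
  by (cases \<nu> rule: pairs.cases) auto

end

section \<open>Reduction to normal forms modulo a T-ideal\<close>

text \<open>
  \<open>J\<close> is an arbitrary T-ideal containing the generators; it will be both the ideal of identities
  and any of the ideals whose intersection is the generated one.
\<close>

locale UT2_generated = UT2_action W \<phi> i0 i1 i2
  for W :: "('f::field_char_0, 'w::ring_1, 'i) graded_algebra" and \<phi> i0 i1 i2 +
  fixes J :: "('i, 'f) wpoly set"
  assumes T_ideal_J: "T_ideal W J" and generators_J: "generators \<subseteq> J"
begin

lemma subspace_J: "wpoly.subspace J"
  and pmult_J: "p \<in> J \<Longrightarrow> pmult W p q \<in> J" "p \<in> J \<Longrightarrow> pmult W q p \<in> J"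
  and lact_J: "p \<in> J \<Longrightarrow> lact W a p \<in> J"
  and ract_J: "p \<in> J \<Longrightarrow> ract W p a \<in> J"
  and endo_J: "graded_endo W h \<Longrightarrow> p \<in> J \<Longrightarrow> h p \<in> J"
  using T_ideal_J by (auto simp: T_ideal_def image_subset_iff)

lemmas J_0 = wpoly.subspace_0[OF subspace_J]
lemmas J_add = wpoly.subspace_add[OF subspace_J]
lemmas J_diff = wpoly.subspace_diff[OF subspace_J]

lemma J_trans: "p - q \<in> J \<Longrightarrow> q - r \<in> J \<Longrightarrow> p - r \<in> J"
  using J_add[of "p - q" "q - r"] by simp

lemma J_sym: "p - q \<in> J \<Longrightarrow> q - p \<in> J"
  using J_diff[of 0 "p - q"] J_0 by simp

lemma J_cong: "p - q \<in> J \<Longrightarrow> q \<in> J \<Longrightarrow> p \<in> J"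
  using J_add[of "p - q" q] by simp

lemma pre_J: "p \<in> J \<Longrightarrow> pre i u p \<in> J"
  unfolding pre_eq by (intro lact_J pmult_J)

lemma rename_J:
  assumes "p \<in> J" "\<And>u. var_degree (\<rho> u) = var_degree u"
  shows "lin (\<lambda>m. mpoly (rename \<rho> m)) p \<in> J"
  using endo_J[OF graded_endo_rename] assms by blast

lemma y_commute_J: "mpoly (Pre i0 (Y k) (Mono i0 (Y l) i0)) - mpoly (Pre i0 (Y l) (Mono i0 (Y k) i0)) \<in> J"
proof -
  define \<rho> where "\<rho> u = (case u of Y n \<Rightarrow> Y (if n = 0 then k else l) | Z n \<Rightarrow> Z n)" for u
  have "mpoly (Pre i0 (Y 0) (Mono i0 (Y 1) i0)) - mpoly (Pre i0 (Y 1) (Mono i0 (Y 0) i0)) \<in> J"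
    using generators_J by (auto simp: generators_def pvar_eq basis_i0 expand_1)
  from rename_J[OF this, of \<rho>] show ?thesis
    by (simp add: \<rho>_def lin.diff split: var.splits)
qed

lemma relation_J:
  "mpoly (Mono i1 (Y k) i0) - mpoly (Mono i0 (Y k) i1) \<in> J"
  "mpoly (Mono i0 (Z k) i1) - mpoly (Mono i0 (Z k) i0) \<in> J"
  "mpoly (Mono i1 (Z k) i0) \<in> J"
  "i \<notin> {i0, i1, i2} \<Longrightarrow> mpoly (Mono i0 u i) \<in> J"
  "i \<notin> {i0, i1, i2} \<Longrightarrow> mpoly (Mono i u i0) \<in> J"
proof -
  define \<rho> where "\<rho> k u = (case u of Y n \<Rightarrow> Y k | Z n \<Rightarrow> Z k)" for k u
  have \<rho>: "var_degree (\<rho> k u) = var_degree u" "\<rho> k (Y n) = Y k" "\<rho> k (Z n) = Z k" for k u n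
    by (auto simp: \<rho>_def split: var.splits)
  note ren = rename_J[where \<rho> = "\<rho> _", OF _ \<rho>(1)]
  have gen: "mpoly (Mono i1 (Y 0) i0) - mpoly (Mono i0 (Y 0) i1) \<in> J"
    "mpoly (Mono i0 (Z 0) i1) - mpoly (Mono i0 (Z 0) i0) \<in> J"
    "mpoly (Mono i1 (Z 0) i0) \<in> J"
    using generators_J by (auto simp: generators_def pvar_eq basis_i0 expand_1)
  show "mpoly (Mono i1 (Y k) i0) - mpoly (Mono i0 (Y k) i1) \<in> J"
    "mpoly (Mono i0 (Z k) i1) - mpoly (Mono i0 (Z k) i0) \<in> J"
    "mpoly (Mono i1 (Z k) i0) \<in> J"
    using gen[THEN ren, of k] by (simp_all add: lin.diff \<rho>)
  assume "i \<notin> {i0, i1, i2}"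
  then have "mpoly (Mono i0 (Y 0) i) \<in> J" "mpoly (Mono i (Y 0) i0) \<in> J"
    "mpoly (Mono i0 (Z 0) i) \<in> J" "mpoly (Mono i (Z 0) i0) \<in> J"
    using generators_J by (auto simp: generators_def pvar_eq basis_i0 expand_1)
  from this[THEN ren] show "mpoly (Mono i0 u i) \<in> J" "mpoly (Mono i u i0) \<in> J"
    by (cases u; simp add: \<rho>)+
qed

lemma Mono_kernel_J:
  assumes "i \<notin> {i0, i1, i2}"
  shows "mpoly (Mono i u j) \<in> J" "mpoly (Mono j u i) \<in> J"
  using ract_J[OF relation_J(5)[OF assms, of u], of "basisW W j"]
    lact_J[OF relation_J(4)[OF assms, of u], of "basisW W j"]
  by (simp_all add: basis_i0)

text \<open>
  The kernel of \<open>\<phi>\<close> is spanned by the remaining basis elements, so modulo \<open>J\<close> a coefficient next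
  to a variable matters only through its image under \<open>\<phi>\<close>.  This allows computing with \<open>w\<^sub>1\<close> and
  \<open>w\<^sub>2\<close> as with the matrix units.
\<close>
lemma expand_kernel_J:
  assumes "\<And>k. k \<notin> {i0, i1, i2} \<Longrightarrow> mpoly (g k) \<in> J" "\<phi> a = 0"
  shows "expand W g a \<in> J"
  unfolding expand_eq
proof (intro wpoly.subspace_sum[OF subspace_J] wpoly.subspace_scale[OF subspace_J] assms(1))
  fix k assume "k \<in> {k. coef W a k \<noteq> 0}"
  then show "k \<notin> {i0, i1, i2}" using coef_kernel[OF assms(2)] by auto
qed

lemma expand_cong_J:
  assumes "\<And>k. k \<notin> {i0, i1, i2} \<Longrightarrow> mpoly (g k) \<in> J" "\<phi> a = \<phi> (basisW W l)"
  shows "expand W g a - mpoly (g l) \<in> J"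
proof -
  have "expand W g (a - basisW W l) \<in> J"
    using assms by (intro expand_kernel_J) (auto simp: phi.diff)
  then show ?thesis by (simp add: expand_diff)
qed

lemma phi_products:
  "\<phi> (basisW W i1 * basisW W i1) = \<phi> (basisW W i1)"
  "\<phi> (basisW W i2 * basisW W i1) = \<phi> (basisW W i2)"
  "\<phi> (basisW W i1 * basisW W i2) = 0"
  by (auto simp: phi_mult phi_i1 phi_i2 matrix2_simps)

text \<open>
  From \<open>w\<^sub>1 y = y w\<^sub>1\<close>: multiplying by \<open>w\<^sub>1\<close> on the right gives \<open>w\<^sub>1 y w\<^sub>1 = y w\<^sub>1\<close>, by \<open>w\<^sub>2\<close> on the
  right \<open>w\<^sub>1 y w\<^sub>2 = y w\<^sub>1 w\<^sub>2 = 0\<close>, by \<open>w\<^sub>2\<close> on the left \<open>w\<^sub>2 y w\<^sub>1 = w\<^sub>2 w\<^sub>1 y = w\<^sub>2 y\<close>, and then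
  \<open>w\<^sub>2 y w\<^sub>2 = w\<^sub>2 y w\<^sub>1 w\<^sub>2 = 0\<close>.
\<close>

lemma Mono_Y_J:
  "mpoly (Mono i1 (Y k) i1) - mpoly (Mono i0 (Y k) i1) \<in> J"
  "mpoly (Mono i1 (Y k) i2) \<in> J"
  "mpoly (Mono i2 (Y k) i1) - mpoly (Mono i2 (Y k) i0) \<in> J"
  "mpoly (Mono i2 (Y k) i2) \<in> J"
proof -
  let ?w = "basisW W" and ?R = "\<lambda>i. expand W (Mono i (Y k))" and ?L = "\<lambda>j. expand W (\<lambda>i. Mono i (Y k) j)"
  have R: "mpoly (Mono i1 (Y k) j) - ?R i0 (?w i1 * ?w j) \<in> J" for j
    using ract_J[OF relation_J(1)[of k], of "?w j"] by (simp add: ract.diff basis_i0)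
  have L: "?L i0 (?w i * ?w i1) - mpoly (Mono i (Y k) i1) \<in> J" for i
    using lact_J[OF relation_J(1)[of k], of "?w i"] by (simp add: lact.diff basis_i0)
  show "mpoly (Mono i1 (Y k) i1) - mpoly (Mono i0 (Y k) i1) \<in> J"
    using J_trans[OF R expand_cong_J] Mono_kernel_J(2) phi_products(1) by blast
  show "mpoly (Mono i1 (Y k) i2) \<in> J"
    using J_cong[OF R expand_kernel_J] Mono_kernel_J(2) phi_products(3) by blast
  show 21: "mpoly (Mono i2 (Y k) i1) - mpoly (Mono i2 (Y k) i0) \<in> J"
    by (rule J_trans[OF J_sym[OF L] expand_cong_J]) (use Mono_kernel_J(1) phi_products(2) in auto)
  have "?R i2 (?w i1 * ?w i2) - mpoly (Mono i2 (Y k) i2) \<in> J"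
    using ract_J[OF 21, of "?w i2"] by (simp add: ract.diff basis_i0)
  then show "mpoly (Mono i2 (Y k) i2) \<in> J"
    by (rule J_cong[OF J_sym expand_kernel_J]) (use Mono_kernel_J(2) phi_products(3) in auto)
qed

text \<open>
  Likewise \<open>w\<^sub>1 z = 0\<close> gives \<open>w\<^sub>2 z = w\<^sub>2 w\<^sub>1 z = 0\<close>, and \<open>z w\<^sub>1 = z\<close> gives \<open>z w\<^sub>2 = z w\<^sub>1 w\<^sub>2 = 0\<close>.
\<close>
lemma Mono_Z_J:
  "mpoly (Mono i1 (Z k) j) \<in> J"
  "mpoly (Mono i2 (Z k) j) \<in> J"
  "mpoly (Mono i (Z k) i2) \<in> J"
  "mpoly (Mono i (Z k) i1) - mpoly (Mono i (Z k) i0) \<in> J"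
proof -
  let ?w = "basisW W"
  show "mpoly (Mono i1 (Z k) j) \<in> J"
    using ract_J[OF relation_J(3)[of k], of "?w j"] by (simp add: basis_i0)
  have "expand W (\<lambda>i. Mono i (Z k) i0) (?w i2 * ?w i1) - mpoly (Mono i2 (Z k) i0) \<in> J"
    by (rule expand_cong_J) (use Mono_kernel_J(1) phi_products(2) in auto)
  moreover have "expand W (\<lambda>i. Mono i (Z k) i0) (?w i2 * ?w i1) \<in> J"
    using lact_J[OF relation_J(3)[of k], of "?w i2"] by simp
  ultimately have "mpoly (Mono i2 (Z k) i0) \<in> J"
    by (rule J_cong[OF J_sym])
  from ract_J[OF this, of "?w j"] show "mpoly (Mono i2 (Z k) j) \<in> J"
    by (simp add: basis_i0)
  have "expand W (Mono i0 (Z k)) (?w i1 * ?w i2) - mpoly (Mono i0 (Z k) i2) \<in> J"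
    using ract_J[OF relation_J(2)[of k], of "?w i2"] by (simp add: ract.diff basis_i0)
  then have "mpoly (Mono i0 (Z k) i2) \<in> J"
    by (rule J_cong[OF J_sym expand_kernel_J]) (use Mono_kernel_J(2) phi_products(3) in auto)
  from lact_J[OF this, of "?w i"] show "mpoly (Mono i (Z k) i2) \<in> J"
    by (simp add: basis_i0)
  show "mpoly (Mono i (Z k) i1) - mpoly (Mono i (Z k) i0) \<in> J"
    using lact_J[OF relation_J(2)[of k], of "?w i"] by (simp add: lact.diff basis_i0)
qed

lemma lact_word: "ps \<noteq> [] \<Longrightarrow> lact W (basisW W i) (mpoly (word i0 ps)) = mpoly (word i ps)"
  by (cases ps rule: word.cases[of "(i0, ps)" for ps]) (auto simp: basis_i0)

lemma append_J:
  assumes "mpoly (Mono i u j) \<in> J"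
  shows "mpoly (word i ((u, j) # ps)) \<in> J"
proof (cases "ps = []")
  case False
  then show ?thesis
    using pmult_J(1)[OF assms, of "mpoly (word i0 ps)"] lact_word[OF False, of j]
    by (simp add: word_Cons)
qed (use assms in simp)

lemma append_diff_J:
  assumes "mpoly (Mono i u j) - mpoly (Mono i' u' j') \<in> J"
  shows "mpoly (word i ((u, j) # ps)) - mpoly (word i' ((u', j') # ps)) \<in> J"
proof (cases "ps = []")
  case False
  then show ?thesis
    using pmult_J(1)[OF assms, of "mpoly (word i0 ps)"] lact_word[OF False]
    by (simp add: word_Cons pmult_left.diff)
qed (use assms in simp)

lemma swap_J:
  "mpoly (word i ((Y k, i0) # (Y l, j) # ps)) - mpoly (word i ((Y l, i0) # (Y k, j) # ps)) \<in> J"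
proof -
  have "mpoly (Pre i (Y k) (Mono i0 (Y l) j)) - mpoly (Pre i (Y l) (Mono i0 (Y k) j)) \<in> J"
    using lact_J[OF ract_J[OF y_commute_J[of k l], of "basisW W j"], of "basisW W i"]
    by (simp add: ract.diff lact.diff basis_i0)
  from pmult_J(1)[OF this, of "mpoly (word i0 ps)"] this show ?thesis
    using lact_word[of ps j] by (cases "ps = []") (simp_all add: word_Cons pmult_left.diff)
qed

lemma prepend_J:
  "ps \<noteq> [] \<Longrightarrow> mpoly (word j ps) \<in> J \<Longrightarrow> mpoly (word i ((u, j) # ps)) \<in> J"
  using pre_J[of "mpoly (word j ps)" i u] by (simp add: word_Cons)

lemma prepend_diff_J:
  "ps \<noteq> [] \<Longrightarrow> qs \<noteq> [] \<Longrightarrow> mpoly (word j ps) - mpoly (word l qs) \<in> J \<Longrightarrow>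
    mpoly (word i ((u, j) # ps)) - mpoly (word i ((u, l) # qs)) \<in> J"
  using pre_J[of "mpoly (word j ps) - mpoly (word l qs)" i u] by (simp add: word_Cons pre.diff)

text \<open>Insertion into a sorted list is a chain of adjacent transpositions.\<close>
lemma insort_J:
  "mpoly (word i (y_pairs (k # L) i0 j @ ps)) - mpoly (word i (y_pairs (insort k L) i0 j @ ps)) \<in> J"
proof (induction L arbitrary: i)
  case (Cons x L)
  show ?case
  proof (cases "k \<le> x")
    case False
    have "mpoly (word i (y_pairs (k # x # L) i0 j @ ps)) - mpoly (word i (y_pairs (x # k # L) i0 j @ ps)) \<in> J"
      using swap_J by simp
    moreover have "mpoly (word i (y_pairs (x # k # L) i0 j @ ps))
        - mpoly (word i (y_pairs (x # insort k L) i0 j @ ps)) \<in> J"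
      using prepend_diff_J[OF _ _ Cons.IH, of i "Y x"] by (cases "insort k L") auto
    ultimately show ?thesis using False by (simp only: insort_key.simps if_False J_trans)
  qed (simp add: J_0)
qed (simp add: J_0)

lemma sorted_y_insert_J:
  "mpoly (word i ((Y k, if A = {#} then j else i0) # sorted_y A j @ ps))
    - mpoly (word i (sorted_y (add_mset k A) j @ ps)) \<in> J"
  using insort_J[of i k "sorted_list_of_multiset A" j ps]
  by (simp add: sorted_list_of_multiset_insert)

text \<open>
  Suppose that \<open>w\<^sub>1\<close> kills a tail.  Then \<open>w\<^sub>1\<close> and \<open>w\<^sub>2\<close> kill \<open>y\<close> times the tail, because
  \<open>w\<^sub>1 y = y w\<^sub>1\<close> and \<open>w\<^sub>2 y = w\<^sub>2 y w\<^sub>1\<close>, and \<open>z\<close> times the tail is zero, because \<open>z = z w\<^sub>1\<close>.  The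
  normal forms \<open>y\<^sub>A w\<^sub>2 y\<^sub>B\<close> with nonempty \<open>A\<close> and all \<open>y\<^sub>A z\<^sub>k y\<^sub>B\<close> are such tails.
\<close>
lemma Y_prepend_J:
  assumes "ps \<noteq> []" "mpoly (word i1 ps) \<in> J"
  shows "mpoly (word i1 ((Y k, i0) # ps)) \<in> J" "mpoly (word i2 ((Y k, i0) # ps)) \<in> J"
proof -
  have "mpoly (word i ((Y k, i1) # ps)) \<in> J" for i
    using assms by (rule prepend_J)
  then show "mpoly (word i1 ((Y k, i0) # ps)) \<in> J" "mpoly (word i2 ((Y k, i0) # ps)) \<in> J"
    using J_cong[OF append_diff_J[OF relation_J(1)]]
      J_cong[OF J_sym[OF append_diff_J[OF Mono_Y_J(3)]]] by blast+
qed

lemma Z_prepend_J: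
  assumes "ps \<noteq> []" "mpoly (word i1 ps) \<in> J"
  shows "mpoly (word i ((Z k, i0) # ps)) \<in> J"
  using J_cong[OF J_sym[OF append_diff_J[OF Mono_Z_J(4)]] prepend_J[OF assms]] .

lemma i1_Z_J: "mpoly (word i1 (y_pairs L i0 i0 @ (Z k, i0) # ps)) \<in> J"
  by (induction L) (auto intro: append_J Mono_Z_J Y_prepend_J)

lemma i1_i2_J: "L \<noteq> [] \<Longrightarrow> mpoly (word i1 (y_pairs L i0 i2 @ ps)) \<in> J"
proof (induction L)
  case (Cons k L)
  then show ?case by (cases "L = []") (auto intro: append_J Mono_Y_J Y_prepend_J)
qed simp

lemma i1_Upper_J:
  assumes "A \<noteq> {#} \<or> s \<noteq> None"
  shows "pairs (Upper A s B) \<noteq> []" "front (Upper A s B) = i0" "mpoly (word i1 (pairs (Upper A s B))) \<in> J"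
  using assms by (cases s; auto simp: front_def intro: i1_Z_J i1_i2_J)+

text \<open>
  The multiplication table for the normal forms.  Since \<open>front\<close> and \<open>pairs\<close> also make sense for
  the shapes of \<open>1\<close>, \<open>w\<^sub>1\<close> and \<open>w\<^sub>2\<close>, this also covers monomials in a single variable.
\<close>
lemma cons_normal_J:
  assumes "\<nu> \<noteq> Zero"
  shows "mpoly (word i ((u, front \<nu>) # pairs \<nu>)) - normal_poly (act_shape i (cons_var u \<nu>)) \<in> J"
proof -
  consider (kernel) "i \<notin> {i0, i1, i2}" | (Y) k where "i \<in> {i0, i1, i2}" "u = Y k"
    | (Z) k where "i \<in> {i0, i1, i2}" "u = Z k"
    by (cases u) auto
  then show ?thesis
  proof cases
    case kernel
    then show ?thesis by (simp add: normal_poly_def append_J Mono_kernel_J)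
  next
    case Y
    have sort0: "mpoly (word i ((Y k, i0) # sorted_y L i0))
        - mpoly (word i (sorted_y (add_mset k L) i0)) \<in> J" for i L
      using sorted_y_insert_J[of i k L i0 "[]"] by simp
    show ?thesis
    proof (cases \<nu>)
      case (Plain L)
      then show ?thesis using Y indices_distinct sort0
        by (auto simp: normal_poly_def normal_mono_def front_def)
    next
      case (Corner L)
      have "mpoly (word i0 ((Y k, i1) # ps)) - mpoly (word i1 ((Y k, i0) # ps)) \<in> J" for ps
        by (rule J_sym[OF append_diff_J[OF relation_J(1)]])
      moreover have "mpoly (word i1 ((Y k, i1) # ps)) - mpoly (word i0 ((Y k, i1) # ps)) \<in> J" for ps
        by (rule append_diff_J[OF Mono_Y_J(1)])
      moreover have "mpoly (word i2 ((Y k, i1) # ps)) - mpoly (word i2 ((Y k, i0) # ps)) \<in> J" for ps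
        by (rule append_diff_J[OF Mono_Y_J(3)])
      ultimately have step: "mpoly (word i ((Y k, i1) # ps))
          - mpoly (word (if i = i2 then i2 else i1) ((Y k, i0) # ps)) \<in> J" for ps
        using Y indices_distinct by (auto intro: J_trans)
      show ?thesis using J_trans[OF step sort0] Y Corner indices_distinct
        by (auto simp: normal_poly_def normal_mono_def front_def)
    next
      case (Upper A s B)
      have top: "mpoly (word i0 ((Y k, front \<nu>) # pairs \<nu>)) - mpoly (normal_mono (Upper (add_mset k A) s B)) \<in> J"
        using sorted_y_insert_J[of i0 k A i2 "sorted_y B i0"]
          sorted_y_insert_J[of i0 k A i0 "(Z l, i0) # sorted_y B i0" for l]
        by (cases s) (auto simp: Upper normal_mono_def front_def)
      have "mpoly (word i1 ((Y k, front \<nu>) # pairs \<nu>)) \<in> J \<and> mpoly (word i2 ((Y k, front \<nu>) # pairs \<nu>)) \<in> J"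
      proof (cases "A = {#} \<and> s = None")
        case True
        then show ?thesis
          using append_J[OF Mono_Y_J(2)] append_J[OF Mono_Y_J(4)] by (simp add: Upper front_def)
      next
        case False
        then show ?thesis
          using Y_prepend_J i1_Upper_J[of A s B] by (simp add: Upper)
      qed
      with top Y show ?thesis
        by (auto simp: Upper normal_poly_def simp del: pairs.simps)
    qed (use assms in simp)
  next
    case Z
    show ?thesis
    proof (cases \<nu>)
      case (Plain L)
      then show ?thesis using Z append_J[OF Mono_Z_J(1)] append_J[OF Mono_Z_J(2)]
        by (auto simp: normal_poly_def normal_mono_def front_def J_0)
    next
      case (Corner L)
      then show ?thesis using Z append_J[OF Mono_Z_J(1)] append_J[OF Mono_Z_J(2)]
          append_diff_J[OF Mono_Z_J(4)]
        by (auto simp: normal_poly_def normal_mono_def front_def)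
    next
      case (Upper A s B)
      have "mpoly (word i ((Z k, front \<nu>) # pairs \<nu>)) \<in> J"
      proof (cases "A = {#} \<and> s = None")
        case True
        then show ?thesis using append_J[OF Mono_Z_J(3)] by (simp add: Upper front_def)
      next
        case False
        then show ?thesis using Z_prepend_J i1_Upper_J[of A s B] by (simp add: Upper)
      qed
      then show ?thesis by (simp add: Upper Z normal_poly_def)
    qed (use assms in simp)
  qed
qed

lemma mono_normal_J: "mpoly m - normal_poly (mono_shape m) \<in> J"
proof (induction m)
  case (Mono i u j)
  let ?\<nu> = "act_shape j (Plain {#})"
  show ?case
  proof (cases "j \<in> {i0, i1, i2}")
    case True
    then have "?\<nu> \<noteq> Zero" "front ?\<nu> = j" "pairs ?\<nu> = []"
      using indices_distinct by (auto simp: front_def)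
    then show ?thesis using cons_normal_J[of ?\<nu> i u] by simp
  qed (simp add: normal_poly_def Mono_kernel_J)
next
  case (Pre i u m)
  show ?case
  proof (cases "mono_shape m = Zero")
    case True
    then show ?thesis using Pre.IH pre_J[of "mpoly m" i u] by (simp add: normal_poly_def)
  next
    case False
    let ?\<nu> = "mono_shape m"
    have "pairs ?\<nu> \<noteq> []"
      using content_mono_shape[OF False] by (intro pairs_nonempty) (cases m; simp)
    then have "mpoly (Pre i u m) - mpoly (word i ((u, front ?\<nu>) # pairs ?\<nu>)) \<in> J"
      using pre_J[OF Pre.IH, of i u] False
      by (simp add: normal_poly_def normal_mono_def pre.diff word_Cons)
    then show ?thesis using J_trans cons_normal_J[OF False] by simp
  qed
qed

end

section \<open>The ideal of identities\<close>

context UT2_action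
begin

text \<open>
  Starting from the empty tail, the shape of a word can be computed factor by factor, even where
  the remaining tail contains no variable.
\<close>
primrec word_shape :: "(var \<times> 'i) list \<Rightarrow> shape" where
  "word_shape [] = Plain {#}"
| "word_shape (q # ps) = cons_var (fst q) (act_shape (snd q) (word_shape ps))"

lemma mono_shape_word: "ps \<noteq> [] \<Longrightarrow> mono_shape (word i ps) = act_shape i (word_shape ps)"
  by (induction i ps rule: word.induct) auto

lemma word_shape_y_pairs:
  "act_shape (if L = [] then j else i0) (word_shape (y_pairs L i0 j @ ps))
    = foldr (\<lambda>k. cons_var (Y k)) L (act_shape j (word_shape ps))"
proof (induction L)
  case (Cons k L)
  then show ?case by (cases "L = []") simp_all
qed simp

lemma foldr_cons_Y:
  "foldr (\<lambda>k. cons_var (Y k)) L (Plain M) = Plain (mset L + M)"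
  "foldr (\<lambda>k. cons_var (Y k)) L (Corner M) = Corner (mset L + M)"
  "foldr (\<lambda>k. cons_var (Y k)) L (Upper A s B) = Upper (mset L + A) s B"
  by (induction L) auto

lemma word_shape_sorted_y: "word_shape (sorted_y L i0) = Plain L"
  using word_shape_y_pairs[of "sorted_list_of_multiset L" i0 "[]"] by (simp add: foldr_cons_Y)

lemma mono_shape_normal_mono:
  assumes "\<nu> \<noteq> Zero" "content \<nu> \<noteq> {#}"
  shows "mono_shape (normal_mono \<nu>) = \<nu>"
  unfolding normal_mono_def mono_shape_word[OF pairs_nonempty[OF assms(2)]]
proof (cases \<nu> rule: pairs.cases)
  case (4 A B)
  then show "act_shape (front \<nu>) (word_shape (pairs \<nu>)) = \<nu>"
    using word_shape_y_pairs[of "sorted_list_of_multiset A" i2 "sorted_y B i0"]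
    by (simp add: front_def foldr_cons_Y word_shape_sorted_y)
next
  case (5 A k B)
  then show "act_shape (front \<nu>) (word_shape (pairs \<nu>)) = \<nu>"
    using word_shape_y_pairs[of "sorted_list_of_multiset A" i0 "(Z k, i0) # sorted_y B i0"]
    by (simp add: front_def foldr_cons_Y word_shape_sorted_y)
qed (use assms in \<open>auto simp: front_def word_shape_sorted_y\<close>)

lemma content_mono_shape_nonempty: "mono_shape m \<noteq> Zero \<Longrightarrow> content (mono_shape m) \<noteq> {#}"
  by (cases m) (simp_all add: content_mono_shape del: mono_shape.simps)

definition normalize :: "('i, 'f) wpoly \<Rightarrow> ('i, 'f) wpoly" where
  "normalize = lin (\<lambda>m. normal_poly (mono_shape m))"

lemma linear_normalize: "Vector_Spaces.linear pscale pscale normalize"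
  unfolding normalize_def by (rule linear_lin)

lemma keys_normalize:
  assumes "m \<in> Poly_Mapping.keys (normalize p)"
  shows "mono_shape m \<noteq> Zero" "normal_mono (mono_shape m) = m"
proof -
  obtain m' where "m \<in> Poly_Mapping.keys (pscale (Poly_Mapping.lookup p m') (normal_poly (mono_shape m')))"
    using assms keys_sum unfolding normalize_def lin_def by fast
  then have "Poly_Mapping.lookup (normal_poly (mono_shape m')) m \<noteq> 0"
    by (simp add: in_keys_iff lookup_pscale)
  then have "mono_shape m' \<noteq> Zero" "m = normal_mono (mono_shape m')"
    by (auto simp: normal_poly_def lookup_single when_def split: if_splits)
  then show "mono_shape m \<noteq> Zero" "normal_mono (mono_shape m) = m"
    by (simp_all add: mono_shape_normal_mono content_mono_shape_nonempty)
qed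

lemma (in UT2_generated) normalize_J: "p - normalize p \<in> J"
proof -
  have "p - normalize p = lin (\<lambda>m. mpoly m - normal_poly (mono_shape m)) p"
    by (simp add: linear_lin_fun normalize_def lin_id)
  also have "\<dots> \<in> J" by (intro lin_in_subspace subspace_J mono_normal_J)
  finally show ?thesis .
qed

text \<open>
  Taking \<open>J\<close> to be the ideal of identities itself shows that \<open>p\<close> and \<open>normalize p\<close> are identities
  together.  The normal form has monomials of pairwise distinct shapes, so it is an identity only
  if it is zero.
\<close>
lemma normalize_identity: "p \<in> identities W (UT2 \<phi>) \<longleftrightarrow> normalize p = 0"
proof -
  interpret Id: UT2_generated W \<phi> i0 i1 i2 "identities W (UT2 \<phi>)"
    by unfold_locales (rule T_ideal_identities generators_identities)+
  show ?thesis
  proof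
    assume "p \<in> identities W (UT2 \<phi>)"
    then have "normalize p \<in> identities W (UT2 \<phi>)"
      using Id.J_diff[OF _ Id.normalize_J[of p]] by fastforce
    then show "normalize p = 0"
      by (rule identity_zero_if_shapes_distinct)
        (auto simp: keys_normalize intro: inj_on_inverseI[of _ normal_mono] dest: keys_normalize(1))
  qed (use Id.normalize_J[of p] in simp)
qed

lemma identities_generated: "identities W (UT2 \<phi>) = T_ideal_generated W generators"
proof
  show "T_ideal_generated W generators \<subseteq> identities W (UT2 \<phi>)"
    using T_ideal_identities generators_identities by (auto simp: T_ideal_generated_def)
  show "identities W (UT2 \<phi>) \<subseteq> T_ideal_generated W generators"
    unfolding T_ideal_generated_def
  proof clarify
    fix p J assume p: "p \<in> identities W (UT2 \<phi>)" and J: "T_ideal W J" "generators \<subseteq> J"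
    interpret UT2_generated W \<phi> i0 i1 i2 J
      by unfold_locales (fact J)+
    show "p \<in> J" using p normalize_J[of p] by (simp add: normalize_identity)
  qed
qed

end

section \<open>Codimensions\<close>

text \<open>
  If \<open>U\<close> is the kernel of a linear map \<open>T\<close> on \<open>V\<close>, then \<open>T\<close> maps every basis of the quotient
  \<open>V / U\<close> injectively to a basis of \<open>T ` V\<close>.  So all these bases have the same size, which makes
  the choice in \<open>quotient_dim\<close> harmless.
\<close>
lemma card_quotient_basis:
  assumes "vector_space s" and T: "Vector_Spaces.linear s s T" and V: "module.subspace s V"
    and U: "U = {v \<in> V. T v = 0}" and B: "quotient_basis s V U B"
  shows "card B = vector_space.dim s (T ` V)"
proof -
  interpret vector_space s by fact
  interpret T: Vector_Spaces.linear s s T by fact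
  have fin: "finite B" and BV: "B \<subseteq> V"
    and gen: "\<And>v. v \<in> V \<Longrightarrow> \<exists>c. v - (\<Sum>b\<in>B. s (c b) b) \<in> U"
    and ind: "\<And>c. (\<Sum>b\<in>B. s (c b) b) \<in> U \<Longrightarrow> \<forall>b\<in>B. c b = 0"
    using B by (auto simp: quotient_basis_def)
  have ind': "\<forall>b\<in>B. c b = 0" if "(\<Sum>b\<in>B. s (c b) (T b)) = 0" for c
  proof (rule ind)
    have "(\<Sum>b\<in>B. s (c b) b) \<in> V"
      using BV by (intro subspace_sum[OF V] subspace_scale[OF V]) auto
    with that show "(\<Sum>b\<in>B. s (c b) b) \<in> U" by (simp add: U T.sum T.scale)
  qed
  have inj: "inj_on T B"
  proof (rule inj_onI, rule ccontr)
    fix b b' assume b: "b \<in> B" "b' \<in> B" "T b = T b'" "b \<noteq> b'"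
    define c :: "'b \<Rightarrow> 'a" where "c = (\<lambda>x. (if x = b then 1 else 0) - (if x = b' then 1 else 0))"
    have ite: "s (if P then 1 else 0) v = (if P then v else 0)" for P v by simp
    have "(\<Sum>x\<in>B. s (c x) (T x)) = 0"
      using b fin by (simp add: c_def scale_left_diff_distrib sum_subtractf ite sum.delta)
    from ind'[OF this] have "c b = 0" using b by blast
    then show False using b by (simp add: c_def)
  qed
  have "independent (T ` B)"
  proof
    assume "dependent (T ` B)"
    then obtain c where c: "\<exists>v\<in>T ` B. c v \<noteq> 0" "(\<Sum>v\<in>T ` B. s (c v) v) = 0"
      using fin by (auto simp: dependent_finite)
    have "\<forall>b\<in>B. (c \<circ> T) b = 0"
      using c(2) by (intro ind') (simp add: sum.reindex[OF inj])
    with c(1) show False by auto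
  qed
  moreover have "T ` V \<subseteq> span (T ` B)"
  proof clarify
    fix v assume "v \<in> V"
    then obtain c where "v - (\<Sum>b\<in>B. s (c b) b) \<in> U" using gen by blast
    then have "T v = (\<Sum>b\<in>B. s (c b) (T b))" by (simp add: U T.diff T.sum T.scale)
    moreover have "\<dots> \<in> span (T ` B)" by (intro span_sum span_scale span_base imageI)
    ultimately show "T v \<in> span (T ` B)" by simp
  qed
  ultimately have "card (T ` B) = dim (T ` V)"
    using BV by (intro basis_card_eq_dim) auto
  then show ?thesis by (simp add: card_image[OF inj])
qed

lemma mset_distinct:
  assumes "mset xs = mset_set X" "finite X"
  shows "distinct xs"
proof -
  have "set xs = X" using arg_cong[OF assms(1), of set_mset] assms(2) by simp
  then show ?thesis using assms by (simp add: distinct_count_atmost_1 count_mset_set')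
qed

text \<open>
  The indices of the variables determine \<open>\<sigma>\<close>, and each index occurs only once, so \<open>u\<close> can be read
  off from the variable that carries it.
\<close>
lemma multilinear_monomial_iff:
  "(\<exists>\<sigma> u. \<sigma> permutes {..<n} \<and> (\<forall>k<n. u k \<in> {Y k, Z k}) \<and> vs = map (\<lambda>k. u (\<sigma> k)) [0..<n])
    \<longleftrightarrow> mset (map index vs) = mset_set {..<n}"
proof safe
  fix \<sigma> and u :: "nat \<Rightarrow> var"
  assume \<sigma>: "\<sigma> permutes {..<n}" and u: "\<forall>k<n. u k \<in> {Y k, Z k}"
  have "index (u (\<sigma> k)) = \<sigma> k" if "k < n" for k
  proof -
    have "\<sigma> k < n" using permutes_in_image[OF \<sigma>, of k] that by simp
    then show ?thesis using u by fastforce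
  qed
  then have "map index (map (\<lambda>k. u (\<sigma> k)) [0..<n]) = map \<sigma> [0..<n]" by simp
  then have "mset (map index (map (\<lambda>k. u (\<sigma> k)) [0..<n])) = mset (map \<sigma> [0..<n])"
    by (rule arg_cong)
  moreover have "mset (map \<sigma> [0..<n]) = image_mset \<sigma> (mset_set {..<n})"
    by (simp add: lessThan_atLeast0)
  moreover have "\<dots> = mset_set {..<n}"
    using image_mset_mset_set[OF permutes_inj_on[OF \<sigma>]] permutes_image[OF \<sigma>] by metis
  ultimately show "mset (map index (map (\<lambda>k. u (\<sigma> k)) [0..<n])) = mset_set {..<n}" by (simp only:)
next
  assume mset: "mset (map index vs) = mset_set {..<n}"
  define xs where "xs = map index vs"
  have len: "length vs = n"
    using arg_cong[OF mset, of size] by simp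
  have dist: "distinct xs" unfolding xs_def using mset by (rule mset_distinct) simp
  have set: "set xs = {..<n}" using arg_cong[OF mset, of set_mset] by (simp add: xs_def)
  define \<sigma> where "\<sigma> k = (if k < n then xs ! k else k)" for k
  define u where "u x = (if Z x \<in> set vs then Z x else Y x)" for x
  have "bij_betw ((!) xs) {..<n} {..<n}"
    using bij_betw_nth[OF dist, of "{..<n}" "{..<n}"] set len by (simp add: xs_def)
  then have "bij_betw \<sigma> {..<n} {..<n}"
    using bij_betw_cong[of "{..<n}" \<sigma> "(!) xs"] by (simp add: \<sigma>_def)
  then have "\<sigma> permutes {..<n}" by (rule bij_imp_permutes) (simp add: \<sigma>_def)
  moreover have "vs = map (\<lambda>k. u (\<sigma> k)) [0..<n]"
  proof (rule nth_equalityI)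
    fix k assume "k < length vs"
    then have k: "k < n" using len by simp
    have "u (xs ! k) = vs ! k"
    proof (cases "vs ! k")
      case (Y a)
      have "Z a \<notin> set vs"
      proof
        assume "Z a \<in> set vs"
        then obtain l where l: "l < n" "vs ! l = Z a" using len by (auto simp: in_set_conv_nth)
        then have "xs ! l = xs ! k" using k len Y by (simp add: xs_def)
        then have "l = k"
          using nth_eq_iff_index_eq[OF dist, of l k] l(1) k len by (simp add: xs_def)
        then show False using l Y by simp
      qed
      then show ?thesis using k len Y by (simp add: xs_def u_def)
    next
      case (Z a)
      then have "Z a \<in> set vs" using k len by (metis nth_mem)
      then show ?thesis using k len Z by (simp add: xs_def u_def)
    qed
    then show "vs ! k = map (\<lambda>k. u (\<sigma> k)) [0..<n] ! k" using k by (simp add: \<sigma>_def)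
  qed (simp add: len)
  ultimately show "\<exists>\<sigma> u. \<sigma> permutes {..<n} \<and> (\<forall>k<n. u k \<in> {Y k, Z k}) \<and> vs = map (\<lambda>k. u (\<sigma> k)) [0..<n]"
    by (intro exI[of _ \<sigma>] exI[of _ u]) (auto simp: u_def)
qed

lemma multilinear_eq_span:
  "multilinear n = wpoly.span {mpoly m | m. mset (map index (vars m)) = mset_set {..<n}}"
proof -
  have "{mpoly m | m \<sigma> u. \<sigma> permutes {..<n} \<and> (\<forall>k<n. u k \<in> {Y k, Z k}) \<and> vars m = map (\<lambda>k. u (\<sigma> k)) [0..<n]}
    = {mpoly m | m. mset (map index (vars m)) = mset_set {..<n}}"
    using multilinear_monomial_iff by (smt (verit) Collect_cong)
  then show ?thesis unfolding multilinear_def by (rule arg_cong)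
qed

lemma mset_set_split:
  assumes "finite X"
  shows "A + B = mset_set X \<longleftrightarrow> (\<exists>S\<subseteq>X. A = mset_set S \<and> B = mset_set (X - S))"
proof safe
  assume eq: "A + B = mset_set X"
  have "count A x + count B x = (if x \<in> X then 1 else 0)" for x
    using arg_cong[OF eq, of "\<lambda>M. count M x"] assms by (simp add: count_mset_set')
  note cnt = this
  have "set_mset A \<subseteq> X"
    using cnt by (metis add_is_0 not_in_iff subsetI)
  moreover have A: "A = mset_set (set_mset A)"
  proof (rule multiset_eqI)
    fix x
    have "count A x \<le> 1" using cnt[of x] by (cases "x \<in> X") simp_all
    then have "count A x = (if x \<in># A then 1 else 0)"
      by (metis One_nat_def count_greater_eq_one_iff le_antisym not_in_iff)
    then show "count A x = count (mset_set (set_mset A)) x"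
      by (simp add: count_mset_set')
  qed
  moreover have "B = mset_set (X - set_mset A)"
    using calculation mset_set_Diff[OF assms] by (metis add_diff_cancel_left' eq)
  ultimately show "\<exists>S\<subseteq>X. A = mset_set S \<and> B = mset_set (X - S)" by blast
next
  fix S assume "S \<subseteq> X"
  then show "mset_set S + mset_set (X - S) = mset_set X"
    using assms by (metis Diff_disjoint Diff_partition finite_Diff finite_subset mset_set_Union)
qed

definition multilinear_shapes :: "nat \<Rightarrow> shape set" where
  "multilinear_shapes n = {\<nu>. \<nu> \<noteq> Zero \<and> content \<nu> = mset_set {..<n}}"

text \<open>
  The shapes using each of the indices \<open>0, \<dots>, n - 1\<close> once: \<open>Plain\<close> and \<open>Corner\<close> contribute one
  each, \<open>Upper A None B\<close> is given by the subset \<open>A\<close>, and \<open>Upper A (Some k) B\<close> by \<open>k\<close> and a subset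
  of the other indices.  The total is \<open>2 + 2 ^ n + n * 2 ^ (n - 1)\<close>.
\<close>
lemma card_multilinear_shapes:
  assumes "n \<ge> 1"
  shows "finite (multilinear_shapes n)" "card (multilinear_shapes n) = 2 ^ (n - 1) * (n + 2) + 2"
proof -
  let ?X = "{..<n}" and ?f = "\<lambda>S. Upper (mset_set S) None (mset_set ({..<n} - S))"
    and ?g = "\<lambda>(k, S). Upper (mset_set S) (Some k) (mset_set ({..<n} - {k} - S))"
  define P where "P = {Plain (mset_set ?X), Corner (mset_set ?X)}"
  define F where "F = ?f ` Pow ?X"
  define G where "G = ?g ` (SIGMA k:?X. Pow (?X - {k}))"
  have some: "add_mset k (A + B) = mset_set ?X \<longleftrightarrow> k < n \<and> A + B = mset_set (?X - {k})" for A B k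
  proof (cases "k < n")
    case True
    then have "mset_set ?X = add_mset k (mset_set (?X - {k}))" by (intro mset_set.remove) auto
    with True show ?thesis by simp
  next
    case False
    then have "k \<notin># mset_set ?X" by simp
    with False show ?thesis by (metis union_single_eq_member add_mset_add_single)
  qed
  have mem: "\<nu> \<in> multilinear_shapes n \<longleftrightarrow> \<nu> \<in> P \<union> F \<union> G" for \<nu>
  proof (cases \<nu>)
    case (Upper A s B)
    then show ?thesis
      by (cases s) (auto simp: multilinear_shapes_def P_def F_def G_def some mset_set_split)
  qed (auto simp: multilinear_shapes_def P_def F_def G_def)
  then have eq: "multilinear_shapes n = P \<union> F \<union> G" by blast
  have fin: "finite P" "finite F" "finite G" by (auto simp: P_def F_def G_def)
  then show "finite (multilinear_shapes n)" by (simp add: eq)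
  have "inj_on ?f (Pow ?X)"
    by (rule inj_onI) (auto simp: finite_subset mset_set_eq_iff)
  then have F: "card F = 2 ^ n" by (simp add: F_def card_image card_Pow)
  have "inj_on ?g (SIGMA k:?X. Pow (?X - {k}))"
    by (rule inj_onI) (auto simp: mset_set_eq_iff finite_subset[OF _ finite_Diff[OF finite_lessThan]])
  then have "card G = (\<Sum>k<n. card (Pow (?X - {k})))" by (simp add: G_def card_image)
  also have "\<dots> = (\<Sum>k<n. 2 ^ (n - 1))" by (rule sum.cong) (auto simp: card_Pow)
  finally have G: "card G = n * 2 ^ (n - 1)" by simp
  have "card (P \<union> F \<union> G) = card P + card F + card G"
    using fin by (subst card_Un_disjoint; (subst card_Un_disjoint)?) (auto simp: P_def F_def G_def)
  also have "\<dots> = 2 + 2 ^ n + n * 2 ^ (n - 1)" by (simp add: F G P_def)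
  also have "\<dots> = 2 ^ (n - 1) * (n + 2) + 2"
    using assms by (cases n) (auto simp: algebra_simps)
  finally show "card (multilinear_shapes n) = 2 ^ (n - 1) * (n + 2) + 2" by (simp add: eq)
qed

context UT2_action
begin

lemma normalize_normal_mono:
  "\<nu> \<noteq> Zero \<Longrightarrow> content \<nu> \<noteq> {#} \<Longrightarrow> normalize (mpoly (normal_mono \<nu>)) = mpoly (normal_mono \<nu>)"
  by (simp add: normalize_def mono_shape_normal_mono normal_poly_def)

text \<open>
  The normal monomials of the multilinear shapes form a basis of the multilinear polynomials
  modulo the identities: \<open>normalize\<close> maps onto their span, fixes them, and has the identities as
  its kernel.
\<close>
lemma codimension_eq:
  assumes n: "n \<ge> 1"
  shows "codimension W (UT2 \<phi>) n = 2 ^ (n - 1) * (n + 2) + 2"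
proof -
  interpret T: Vector_Spaces.linear pscale pscale normalize by (rule linear_normalize)
  let ?V = "multilinear n :: ('i, 'f) wpoly set" and ?N = "multilinear_shapes n"
  let ?U = "?V \<inter> identities W (UT2 \<phi>)"
  define b where "b \<nu> = (mpoly (normal_mono \<nu>) :: ('i, 'f) wpoly)" for \<nu>
  have ne: "mset_set {..<n} \<noteq> {#}" using n by (simp add: mset_set_empty_iff lessThan_empty_iff)
  have N: "\<nu> \<noteq> Zero" "content \<nu> \<noteq> {#}" "content \<nu> = mset_set {..<n}" if "\<nu> \<in> ?N" for \<nu>
    using that ne by (auto simp: multilinear_shapes_def)
  have shape: "mono_shape (normal_mono \<nu>) = \<nu>" if "\<nu> \<in> ?N" for \<nu>
    using N[OF that] by (intro mono_shape_normal_mono)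
  have V: "wpoly.subspace ?V" by (simp add: multilinear_eq_span)
  have U: "?U = {v \<in> ?V. normalize v = 0}" by (auto simp: normalize_identity)
  have inj: "inj_on b ?N"
    by (rule inj_on_inverseI[of _ "\<lambda>p. mono_shape (the_elem (Poly_Mapping.keys p))"])
      (simp add: b_def shape)
  have bV: "b \<nu> \<in> ?V" if "\<nu> \<in> ?N" for \<nu>
    unfolding multilinear_eq_span b_def
    using N[OF that] shape[OF that] content_mono_shape[of "normal_mono \<nu>"] by (intro wpoly.span_base) auto
  have Tb: "normalize (b \<nu>) = b \<nu>" if "\<nu> \<in> ?N" for \<nu>
    unfolding b_def using N[OF that] by (intro normalize_normal_mono)
  have fin: "finite ?N" using card_multilinear_shapes[OF n] by blast
  have basis: "quotient_basis pscale ?V ?U (b ` ?N)"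
    unfolding quotient_basis_def
  proof (intro conjI ballI allI impI)
    show "finite (b ` ?N)" using fin by simp
    show "b ` ?N \<subseteq> ?V" using bV by blast
  next
    fix v assume v: "v \<in> ?V"
    have "normalize v \<in> wpoly.span (b ` ?N)"
    proof -
      have "?V \<subseteq> normalize -` wpoly.span (b ` ?N)"
        unfolding multilinear_eq_span
      proof (intro wpoly.span_minimal T.subspace_vimage wpoly.subspace_span, clarify)
        fix m :: "'i mono" assume m: "mset (map index (vars m)) = mset_set {..<n}"
        show "mpoly m \<in> normalize -` wpoly.span (b ` ?N)"
        proof (cases "mono_shape m = Zero")
          case True
          then show ?thesis by (simp add: normalize_def normal_poly_def wpoly.span_zero)
        next
          case False
          then have "mono_shape m \<in> ?N"
            using m by (simp add: multilinear_shapes_def content_mono_shape)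
          then show ?thesis using False
            by (auto simp: normalize_def normal_poly_def b_def intro: wpoly.span_base)
        qed
      qed
      with v show ?thesis by blast
    qed
    then obtain c where c: "normalize v = (\<Sum>x\<in>b ` ?N. pscale (c x) x)"
      using fin wpoly.span_finite[of "b ` ?N"] by auto
    have "normalize (normalize v) = normalize v"
      unfolding c by (auto simp: T.sum T.scale Tb intro!: sum.cong)
    moreover have "normalize v \<in> ?V"
      unfolding c using bV by (intro wpoly.subspace_sum wpoly.subspace_scale V) auto
    ultimately have "v - normalize v \<in> ?U"
      unfolding U using v by (simp add: T.diff wpoly.subspace_diff[OF V])
    then show "\<exists>c. v - (\<Sum>x\<in>b ` ?N. pscale (c x) x) \<in> ?U" unfolding c by blast
  next
    fix c x assume c: "(\<Sum>x\<in>b ` ?N. pscale (c x) x) \<in> ?U" and x: "x \<in> b ` ?N"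
    have sum0: "(\<Sum>\<nu>\<in>?N. pscale (c (b \<nu>)) (b \<nu>)) = 0"
      using c Tb by (simp add: U T.sum T.scale sum.reindex[OF inj])
    obtain \<mu> where \<mu>: "\<mu> \<in> ?N" "x = b \<mu>" using x by blast
    have "0 = Poly_Mapping.lookup (\<Sum>\<nu>\<in>?N. pscale (c (b \<nu>)) (b \<nu>)) (normal_mono \<mu>)"
      by (simp add: sum0)
    also have "\<dots> = (\<Sum>\<nu>\<in>?N. if \<nu> = \<mu> then c (b \<nu>) else 0)"
      unfolding lookup_sum using \<mu> shape
      by (intro sum.cong) (auto simp: lookup_pscale b_def lookup_single when_def, metis)
    also have "\<dots> = c x" using fin \<mu> by simp
    finally show "c x = 0" by simp
  qed
  have "codimension W (UT2 \<phi>) n = card (SOME B. quotient_basis pscale ?V ?U B)"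
    using basis by (auto simp: codimension_def quotient_dim_def)
  also have "\<dots> = wpoly.dim (normalize ` ?V)"
    by (rule card_quotient_basis[OF wpoly.vector_space_axioms linear_normalize V U
          someI[of "quotient_basis pscale ?V ?U", OF basis]])
  also have "\<dots> = card (b ` ?N)"
    by (rule card_quotient_basis[OF wpoly.vector_space_axioms linear_normalize V U basis, symmetric])
  also have "\<dots> = 2 ^ (n - 1) * (n + 2) + 2"
    by (simp add: card_image[OF inj] card_multilinear_shapes[OF n])
  finally show ?thesis .
qed

end

theorem corollary5p4:
  fixes W :: "('f::field_char_0, 'w::ring_1, 'i) graded_algebra"
    and \<phi> :: "'w \<Rightarrow> 'f^2^2"
    and i0 i1 i2 :: 'i
  assumes "Z2_graded_algebra W"
    and "onto_UT2 W \<phi>"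
    and "basisW W i0 = 1"
    and "\<phi> (basisW W i1) = munit 2 2"
    and "\<phi> (basisW W i2) = munit 1 2"
    and "\<And>i. i \<notin> {i0, i1, i2} \<Longrightarrow> \<phi> (basisW W i) = 0"
  shows "identities W (UT2 \<phi>) = T_ideal_generated W
      ({pmult W (pvar W (Y 0)) (pvar W (Y 1)) - pmult W (pvar W (Y 1)) (pvar W (Y 0)),
        lact W (basisW W i1) (pvar W (Y 0)) - ract W (pvar W (Y 0)) (basisW W i1),
        ract W (pvar W (Z 0)) (basisW W i1) - pvar W (Z 0),
        lact W (basisW W i1) (pvar W (Z 0))} \<union>
       (\<Union>i\<in>- {i0, i1, i2}.
         {ract W (pvar W (Y 0)) (basisW W i), lact W (basisW W i) (pvar W (Y 0)),
          ract W (pvar W (Z 0)) (basisW W i), lact W (basisW W i) (pvar W (Z 0))}))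
    \<and> (\<forall>n\<ge>1. codimension W (UT2 \<phi>) n = 2 ^ (n - 1) * (n + 2) + 2)"
proof -
  interpret UT2_action W \<phi> i0 i1 i2
    using assms by (intro UT2_action.intro UT2_action_axioms.intro)
  show ?thesis
    using identities_generated codimension_eq unfolding generators_def by blast
qed

end
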